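(* Let $\mathbb G$ be a Carnot group and let $s\in(0,1)$. Then for every $g\in\mathbb G$ and every $y>0$ one has $$\mathscr L^s\big(\mathfrak e^{(s)}(\cdot,y)\big)(g)=(2\pi y)^{2s}\,\mathfrak e^{(-s)}(g,y).$$
   Context: A Carnot group of step $r$ is a simply connected Lie group $\mathbb G$ whose Lie algebra is stratified and $r$-nilpotent: $\mathfrak g=V_1\oplus\dots\oplus V_r$, $[V_1,V_i]=V_{i+1}$ for $i=1,\dots,r-1$, $[V_1,V_r]=\{0\}$. Its homogeneous dimension is $Q=\sum_{j=1}^r j\dim V_j$, and $e$ denotes the identity element. Fix an inner product on $\mathfrak g$ and an orthonormal basis $\{e_1,\dots,e_m\}$ of $V_1$; let $X_j$ be the left-invariant vector field with $X_j(g)=dL_g(e_j)$, $L_g(g')=g\circ g'$, and let $\mathscr L=\sum_{j=1}^mX_j^2$ be the associated horizontal Laplacian. Let $P_t=e^{t\mathscr L}$, $t>0$, be the heat semigroup (for the heat operator $\partial_t-\mathscr L$), and let $p(g,g',t)>0$ be its heat kernel with respect to a fixed Haar measure $dg'$, so $P_tf(g)=\int_{\mathbb G}p(g,g',t)f(g')\,dg'$. Standard facts: $P_t1=1$, and there are constants $C,\alpha,\beta>0$ such that $$C\,t^{-Q/2}e^{-\alpha d(g,g')^2/t}\le p(g,g',t)\le C^{-1}t^{-Q/2}e^{-\beta d(g,g')^2/t},$$ where $d$ is the control (Carnot–Carathéodory) distance. For $0<s<1$ the fractional power $\mathscr L^s=(-\mathscr L)^s$ is defined by $$\mathscr L^su(g)=-\frac{s}{\Gamma(1-s)}\int_0^\infty\frac1{t^{1+s}}\big(P_tu(g)-u(g)\big)\,dt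 .$$ For $t>0$, $y>0$ and each choice of sign put $$q^{(\pm s)}(g,t,y)=\frac1{(4\pi t)^{1\mp s}}e^{-\frac{y^2}{4t}}p(g,e,t),\qquad \mathfrak e^{(\pm s)}(g,y)=\int_0^\infty q^{(\pm s)}(g,t,y)\,dt .$$
   Formalization: The formal statement assumes 2s < Q; this excludes only the trivial group and G = ℝ (Q = 1) with s ≥ 1/2, where the integral defining 𝔢^{(s)}(g,y) diverges for every g and the left-hand side is undefined. *)

theory Defs
  imports "HOL-Analysis.Analysis"
begin

section \<open>Lie groups\<close>

text \<open>
  The underlying set of a group is a whole type \<open>'g\<close>. The class \<^class>\<open>topological_group_add\<close> is not
  commutative: \<open>g + g'\<close> is the group product \<open>g \<circ> g'\<close>, \<open>- g\<close> the inverse and \<open>0\<close> the identity \<open>e\<close>.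
  A smooth structure is given by an atlas, a set of pairs (chart domain, chart map). The charts take
  values in a Euclidean space \<open>'a\<close>, which below also serves as the Lie algebra.
\<close>

primrec Ck_on :: "nat \<Rightarrow> 'a::euclidean_space set \<Rightarrow> ('a \<Rightarrow> 'b::real_normed_vector) \<Rightarrow> bool" where
  "Ck_on 0 S f \<longleftrightarrow> continuous_on S f"
| "Ck_on (Suc k) S f \<longleftrightarrow>
     (\<forall>x\<in>S. f differentiable at x) \<and>
     (\<forall>b\<in>Basis. Ck_on k S (\<lambda>x. frechet_derivative f (at x) b))"

text \<open>Only meant for open \<open>S\<close>.\<close>

definition smooth_on :: "'a::euclidean_space set \<Rightarrow> ('a \<Rightarrow> 'b::real_normed_vector) \<Rightarrow> bool" where
  "smooth_on S f \<longleftrightarrow> (\<forall>k. Ck_on k S f)"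

type_synonym ('g, 'a) atlas = "('g set \<times> ('g \<Rightarrow> 'a)) set"

definition smooth_atlas :: "('g::topological_space, 'a::euclidean_space) atlas \<Rightarrow> bool" where
  "smooth_atlas A \<longleftrightarrow>
     (\<forall>(U, \<phi>)\<in>A. open U \<and> open (\<phi> ` U) \<and> homeomorphism U (\<phi> ` U) \<phi> (inv_into U \<phi>)) \<and>
     \<Union> (fst ` A) = UNIV \<and>
     (\<forall>(U, \<phi>)\<in>A. \<forall>(V, \<psi>)\<in>A. smooth_on (\<phi> ` (U \<inter> V)) (\<psi> \<circ> inv_into U \<phi>))"

definition smooth_fun :: "('g, 'a::euclidean_space) atlas \<Rightarrow> ('g \<Rightarrow> real) \<Rightarrow> bool" where
  "smooth_fun A f \<longleftrightarrow> (\<forall>(U, \<phi>)\<in>A. smooth_on (\<phi> ` U) (f \<circ> inv_into U \<phi>))"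

definition lie_group ::
  "('g::{topological_group_add, t2_space, second_countable_topology}, 'a::euclidean_space) atlas \<Rightarrow> bool"
where
  "lie_group A \<longleftrightarrow>
     smooth_atlas A \<and>
     (\<forall>(U, \<phi>)\<in>A. \<forall>(V, \<psi>)\<in>A. \<forall>(W, \<kappa>)\<in>A.
        smooth_on {(x, y). x \<in> \<phi> ` U \<and> y \<in> \<psi> ` V \<and> inv_into U \<phi> x + inv_into V \<psi> y \<in> W}
          (\<lambda>(x, y). \<kappa> (inv_into U \<phi> x + inv_into V \<psi> y))) \<and>
     (\<forall>(U, \<phi>)\<in>A. \<forall>(W, \<kappa>)\<in>A.
        smooth_on {x \<in> \<phi> ` U. - inv_into U \<phi> x \<in> W} (\<lambda>x. \<kappa> (- inv_into U \<phi> x)))"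


section \<open>The Lie algebra\<close>

text \<open>
  Tangent vectors at the identity are derivations of the algebra of smooth functions; they are
  extended by zero to all other functions, so that equality of functionals is equality of tangent
  vectors.
\<close>

definition tangent_vector_at_identity ::
  "('g::group_add, 'a::euclidean_space) atlas \<Rightarrow> (('g \<Rightarrow> real) \<Rightarrow> real) \<Rightarrow> bool" where
  "tangent_vector_at_identity A D \<longleftrightarrow>
     (\<forall>f h. smooth_fun A f \<longrightarrow> smooth_fun A h \<longrightarrow>
        D (\<lambda>x. f x + h x) = D f + D h \<and>
        D (\<lambda>x. f x * h x) = D f * h 0 + f 0 * D h) \<and>
     (\<forall>c f. smooth_fun A f \<longrightarrow> D (\<lambda>x. c * f x) = c * D f) \<and>
     (\<forall>f. \<not> smooth_fun A f \<longrightarrow> D f = 0)"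

text \<open>
  A linear isomorphism \<open>T\<close> of the Euclidean space \<open>'a\<close> onto the tangent space at the identity. It makes
  \<open>'a\<close> the Lie algebra; the choice of \<open>T\<close> amounts to the choice of an inner product on the Lie algebra
  (every inner product arises in this way).
\<close>

definition lie_algebra_iso ::
  "('g::group_add, 'a::euclidean_space) atlas \<Rightarrow> ('a \<Rightarrow> ('g \<Rightarrow> real) \<Rightarrow> real) \<Rightarrow> bool" where
  "lie_algebra_iso A T \<longleftrightarrow>
     (\<forall>f. linear (\<lambda>v. T v f)) \<and> bij_betw T UNIV {D. tangent_vector_at_identity A D}"

text \<open>The left-invariant vector field \<open>g \<mapsto> dL\<^sub>g(v)\<close>, as a differential operator.\<close>

definition left_invariant_field ::
  "('a \<Rightarrow> ('g \<Rightarrow> real) \<Rightarrow> real) \<Rightarrow> 'a \<Rightarrow> ('g::group_add \<Rightarrow> real) \<Rightarrow> 'g \<Rightarrow> real" where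
  "left_invariant_field T v f g = T v (\<lambda>g'. f (g + g'))"

text \<open>The vector whose left-invariant field is the commutator of the fields of \<open>v\<close> and \<open>w\<close>.\<close>

definition lie_bracket ::
  "('g::group_add, 'a::euclidean_space) atlas \<Rightarrow> ('a \<Rightarrow> ('g \<Rightarrow> real) \<Rightarrow> real) \<Rightarrow> 'a \<Rightarrow> 'a \<Rightarrow> 'a" where
  "lie_bracket A T v w =
     (THE u. \<forall>f. smooth_fun A f \<longrightarrow>
        left_invariant_field T u f =
          (\<lambda>g. left_invariant_field T v (left_invariant_field T w f) g
             - left_invariant_field T w (left_invariant_field T v f) g))"


section \<open>Carnot groups\<close>

definition bracket_span ::
  "('g::group_add, 'a::euclidean_space) atlas \<Rightarrow> ('a \<Rightarrow> ('g \<Rightarrow> real) \<Rightarrow> real) \<Rightarrow>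
    'a set \<Rightarrow> 'a set \<Rightarrow> 'a set" where
  "bracket_span A T V W = span {lie_bracket A T v w | v w. v \<in> V \<and> w \<in> W}"

definition direct_sum :: "(nat \<Rightarrow> 'a::real_vector set) \<Rightarrow> nat \<Rightarrow> bool" where
  "direct_sum V r \<longleftrightarrow>
     (\<forall>i\<in>{1..r}. subspace (V i)) \<and>
     (\<forall>x. \<exists>!c. c \<in> (\<Pi>\<^sub>E i\<in>{1..r}. V i) \<and> x = (\<Sum>i=1..r. c i))"

definition carnot_group ::
  "('g::{topological_group_add, t2_space, second_countable_topology}, 'a::euclidean_space) atlas \<Rightarrow>
    ('a \<Rightarrow> ('g \<Rightarrow> real) \<Rightarrow> real) \<Rightarrow> (nat \<Rightarrow> 'a set) \<Rightarrow> nat \<Rightarrow> bool" where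
  "carnot_group A T V r \<longleftrightarrow>
     lie_group A \<and> simply_connected (UNIV :: 'g set) \<and> lie_algebra_iso A T \<and>
     1 \<le> r \<and> direct_sum V r \<and>
     (\<forall>i\<in>{1..<r}. bracket_span A T (V 1) (V i) = V (i + 1)) \<and>
     bracket_span A T (V 1) (V r) = {0}"

definition homogeneous_dimension :: "(nat \<Rightarrow> 'a::euclidean_space set) \<Rightarrow> nat \<Rightarrow> nat" where
  "homogeneous_dimension V r = (\<Sum>j=1..r. j * dim (V j))"

definition orthonormal_basis_of :: "'a::euclidean_space set \<Rightarrow> 'a set \<Rightarrow> bool" where
  "orthonormal_basis_of E W \<longleftrightarrow> pairwise orthogonal E \<and> (\<forall>v\<in>E. norm v = 1) \<and> span E = W"

definition horizontal_laplacian ::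
  "('a \<Rightarrow> ('g \<Rightarrow> real) \<Rightarrow> real) \<Rightarrow> 'a set \<Rightarrow> ('g::group_add \<Rightarrow> real) \<Rightarrow> 'g \<Rightarrow> real" where
  "horizontal_laplacian T E f g =
     (\<Sum>v\<in>E. left_invariant_field T v (left_invariant_field T v f) g)"

text \<open>
  Trajectories \<open>\<gamma>' = \<Sum>\<^sub>v a\<^sub>v(t) X\<^sub>v(\<gamma>)\<close> on \<open>[0,1]\<close> of the control system given by the fields \<open>X\<^sub>v\<close>, \<open>v \<in> E\<close>,
  with integrable controls. The equation is integrated and tested on smooth functions, which says
  that \<open>\<gamma>\<close> is absolutely continuous and satisfies it almost everywhere.
\<close>

definition horizontal_trajectory ::
  "('g::{topological_space, group_add}, 'a::euclidean_space) atlas \<Rightarrow> ('a \<Rightarrow> ('g \<Rightarrow> real) \<Rightarrow> real) \<Rightarrow>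
    'a set \<Rightarrow> ('a \<Rightarrow> real \<Rightarrow> real) \<Rightarrow> (real \<Rightarrow> 'g) \<Rightarrow> bool" where
  "horizontal_trajectory A T E a \<gamma> \<longleftrightarrow>
     path \<gamma> \<and>
     (\<forall>v\<in>E. set_integrable lborel {0..1} (a v)) \<and>
     (\<forall>f. smooth_fun A f \<longrightarrow> (\<forall>t\<in>{0..1}.
        f (\<gamma> t) - f (\<gamma> 0) =
          (LINT \<tau>:{0..t}|lborel. (\<Sum>v\<in>E. a v \<tau> * left_invariant_field T v f (\<gamma> \<tau>)))))"

definition control_distance ::
  "('g::{topological_space, group_add}, 'a::euclidean_space) atlas \<Rightarrow> ('a \<Rightarrow> ('g \<Rightarrow> real) \<Rightarrow> real) \<Rightarrow>
    'a set \<Rightarrow> 'g \<Rightarrow> 'g \<Rightarrow> real" where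
  "control_distance A T E g g' =
     Inf {LINT t:{0..1}|lborel. sqrt (\<Sum>v\<in>E. (a v t)\<^sup>2) | a \<gamma>.
            horizontal_trajectory A T E a \<gamma> \<and> pathstart \<gamma> = g \<and> pathfinish \<gamma> = g'}"


section \<open>Haar measure, heat semigroup and heat kernel\<close>

definition haar_measure :: "'g::topological_group_add measure \<Rightarrow> bool" where
  "haar_measure \<mu> \<longleftrightarrow>
     sets \<mu> = sets borel \<and>
     (\<forall>g. distr \<mu> borel ((+) g) = \<mu>) \<and>
     (\<forall>K. compact K \<longrightarrow> emeasure \<mu> K < \<infinity>) \<and>
     emeasure \<mu> UNIV \<noteq> 0"

definition C0 :: "('g::topological_space \<Rightarrow> real) set" where
  "C0 = {f. continuous_on UNIV f \<and> (\<forall>\<epsilon>>0. \<exists>K. compact K \<and> (\<forall>x. x \<notin> K \<longrightarrow> \<bar>f x\<bar> < \<epsilon>))}"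

definition test_fun :: "('g::topological_space, 'a::euclidean_space) atlas \<Rightarrow> ('g \<Rightarrow> real) set" where
  "test_fun A = {f. smooth_fun A f \<and> compact (closure {x. f x \<noteq> 0})}"

text \<open>Strongly continuous semigroups of bounded operators on \<^const>\<open>C0\<close> with the supremum norm.\<close>

definition C0_semigroup :: "(real \<Rightarrow> ('g::topological_space \<Rightarrow> real) \<Rightarrow> 'g \<Rightarrow> real) \<Rightarrow> bool" where
  "C0_semigroup P \<longleftrightarrow>
     (\<forall>t>0. \<forall>f\<in>C0. P t f \<in> C0) \<and>
     (\<forall>t>0. \<forall>f\<in>C0. \<forall>h\<in>C0. P t (\<lambda>x. f x + h x) = (\<lambda>x. P t f x + P t h x)) \<and>
     (\<forall>t>0. \<forall>c. \<forall>f\<in>C0. P t (\<lambda>x. c * f x) = (\<lambda>x. c * P t f x)) \<and>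
     (\<forall>t>0. \<exists>M. \<forall>f\<in>C0. \<forall>B. (\<forall>x. \<bar>f x\<bar> \<le> B) \<longrightarrow> (\<forall>x. \<bar>P t f x\<bar> \<le> M * B)) \<and>
     (\<forall>t>0. \<forall>t'>0. \<forall>f\<in>C0. P (t + t') f = P t (P t' f)) \<and>
     (\<forall>f\<in>C0. uniform_limit UNIV (\<lambda>t. P t f) f (at_right 0))"

definition generator_graph ::
  "(real \<Rightarrow> ('g::topological_space \<Rightarrow> real) \<Rightarrow> 'g \<Rightarrow> real) \<Rightarrow> (('g \<Rightarrow> real) \<times> ('g \<Rightarrow> real)) set" where
  "generator_graph P =
     {(f, h). f \<in> C0 \<and> h \<in> C0 \<and> uniform_limit UNIV (\<lambda>t x. (P t f x - f x) / t) h (at_right 0)}"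

text \<open>The graph of the closure in \<^const>\<open>C0\<close> of the horizontal Laplacian on test functions.\<close>

definition laplacian_closure_graph ::
  "('g::{topological_space, group_add}, 'a::euclidean_space) atlas \<Rightarrow> ('a \<Rightarrow> ('g \<Rightarrow> real) \<Rightarrow> real) \<Rightarrow>
    'a set \<Rightarrow> (('g \<Rightarrow> real) \<times> ('g \<Rightarrow> real)) set" where
  "laplacian_closure_graph A T E =
     {(f, h). \<exists>u :: nat \<Rightarrow> 'g \<Rightarrow> real. (\<forall>n. u n \<in> test_fun A) \<and>
        uniform_limit UNIV u f sequentially \<and>
        uniform_limit UNIV (\<lambda>n. horizontal_laplacian T E (u n)) h sequentially}"

text \<open>
  \<open>P\<^sub>t = e\<^bsup>tL\<^esup>\<close>: the strongly continuous semigroup generated by (the closure of) the horizontal Laplacian.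
\<close>

definition heat_semigroup ::
  "('g::{topological_space, group_add}, 'a::euclidean_space) atlas \<Rightarrow> ('a \<Rightarrow> ('g \<Rightarrow> real) \<Rightarrow> real) \<Rightarrow>
    'a set \<Rightarrow> (real \<Rightarrow> ('g \<Rightarrow> real) \<Rightarrow> 'g \<Rightarrow> real) \<Rightarrow> bool" where
  "heat_semigroup A T E P \<longleftrightarrow>
     C0_semigroup P \<and> generator_graph P = laplacian_closure_graph A T E"

definition kernel_operator ::
  "'g measure \<Rightarrow> ('g \<Rightarrow> 'g \<Rightarrow> real \<Rightarrow> real) \<Rightarrow> real \<Rightarrow> ('g \<Rightarrow> real) \<Rightarrow> 'g \<Rightarrow> real" where
  "kernel_operator \<mu> p t f g = (LINT g'|\<mu>. p g g' t * f g')"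

text \<open>
  Continuity singles out the kernel among its modifications on null sets, so that its values
  \<open>p(g,e,t)\<close> are meaningful.
\<close>

definition heat_kernel ::
  "('g::{topological_space, group_add}, 'a::euclidean_space) atlas \<Rightarrow> ('a \<Rightarrow> ('g \<Rightarrow> real) \<Rightarrow> real) \<Rightarrow>
    'a set \<Rightarrow> 'g measure \<Rightarrow> ('g \<Rightarrow> 'g \<Rightarrow> real \<Rightarrow> real) \<Rightarrow> bool" where
  "heat_kernel A T E \<mu> p \<longleftrightarrow>
     (\<forall>g g'. \<forall>t>0. p g g' t > 0) \<and>
     continuous_on (UNIV \<times> UNIV \<times> {0<..}) (\<lambda>(g, g', t). p g g' t) \<and>
     (\<forall>t>0. \<forall>f\<in>C0. \<forall>g. integrable \<mu> (\<lambda>g'. p g g' t * f g')) \<and>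
     heat_semigroup A T E (kernel_operator \<mu> p)"


section \<open>Fractional powers\<close>

definition fractional_laplacian ::
  "'g measure \<Rightarrow> ('g \<Rightarrow> 'g \<Rightarrow> real \<Rightarrow> real) \<Rightarrow> real \<Rightarrow> ('g \<Rightarrow> real) \<Rightarrow> 'g \<Rightarrow> real" where
  "fractional_laplacian \<mu> p s u g =
     - (s / Gamma (1 - s)) *
       (LINT t:{0<..}|lborel. 1 / t powr (1 + s) * (kernel_operator \<mu> p t u g - u g))"

text \<open>
  In the next two definitions \<open>\<sigma>\<close> is the signed parameter \<open>s\<close> or \<open>- s\<close>, so that the exponent
  \<open>1 \<mp> s\<close> is \<open>1 - \<sigma>\<close>.
\<close>

definition q_kernel ::
  "('g::zero \<Rightarrow> 'g \<Rightarrow> real \<Rightarrow> real) \<Rightarrow> real \<Rightarrow> 'g \<Rightarrow> real \<Rightarrow> real \<Rightarrow> real" where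
  "q_kernel p \<sigma> g t y = 1 / (4 * pi * t) powr (1 - \<sigma>) * exp (- y\<^sup>2 / (4 * t)) * p g 0 t"

definition e_kernel ::
  "('g::zero \<Rightarrow> 'g \<Rightarrow> real \<Rightarrow> real) \<Rightarrow> real \<Rightarrow> 'g \<Rightarrow> real \<Rightarrow> real" where
  "e_kernel p \<sigma> g y = (LINT t:{0<..}|lborel. q_kernel p \<sigma> g t y)"

end

theory Submission
  imports Defs "HOL-Real_Asymp.Real_Asymp"
begin

text \<open>
  Up to a constant, \<open>e\<^bsup>(s)\<^esup>(g,y)\<close> is the integral of \<open>w(t) p(g,e,t)\<close> with \<open>w(t) = t\<^bsup>s-1\<^esup> e\<^bsup>-a/t\<^esup>\<close> and \<open>a = y\<^sup>2/4\<close>.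
  By the Chapman-Kolmogorov identity \<open>P\<^sub>\<tau>\<close> translates the time variable of the heat kernel, and moving the
  translation onto \<open>w\<close> (extended by zero) turns the fractional power into the Marchaud derivative of order
  \<open>s\<close> of \<open>w\<close>, which is \<open>a\<^sup>s t\<^bsup>-1-s\<^esup> e\<^bsup>-a/t\<^esup>\<close>, the weight of \<open>e\<^bsup>(-s)\<^esup>\<close>. The bound
  \<open>p \<le> C\<^bsup>-1\<^esup> t\<^bsup>-Q/2\<^esup>\<close> makes the interchange of the two integrals absolutely convergent.
\<close>

section \<open>Power weights with exponential decay at zero\<close>

text \<open>Formally the identity is the symmetry K_s = K_{-s} of the Bessel function. The Laplace
  transform of t^(s-1) exp(-a/t) at \<lambda> is 2 (a/\<lambda>)^(s/2) K_s(2 sqrt(a \<lambda>));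
  multiplying it by \<lambda>^s gives a^s times the same expression with -s in place of s. The
  Marchaud derivative realises this without spectral theory. Moving the translation onto the weight
  also matters for regularity: the kernel is only assumed continuous in time, whereas the weight is
  explicit and differentiable on the whole line.

  The factor exp(-a/t) absorbs the singularity of the kernel at t = 0, so all convergence conditions
  come from large t, where t^(s-1-Q/2) is integrable exactly when 2s < Q. Since s < 1, this is
  automatic for Q >= 2. For Q = 1 and s >= 1/2 the Gaussian lower bound makes the integral e^(s)
  diverge, and the formal integral would take the default value 0.

  The semigroup law is given only on \<open>C0\<close>, while the proof applies it to p(.,e,t) with
  e a single point. This is why a pointwise Chapman-Kolmogorov identity must be extracted
  first.\<close>

definition subordination_weight :: "real \<Rightarrow> real \<Rightarrow> real \<Rightarrow> real" where
  "subordination_weight c a t = (if t > 0 then t powr c * exp (- a / t) else 0)"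

lemma tendsto_subordination_weight:
  assumes "a > 0"
  shows "((\<lambda>t::real. t powr c * exp (- a / t)) \<longlongrightarrow> 0) (at_right 0)"
  using assms by real_asymp

text \<open>The exponential beats every power at 0, so the extension by zero has derivative 0 there,
  for negative \<open>c\<close> as well. Differentiation stays within the family of weights, and the
  formula holds on the whole line, so later applications of the fundamental theorem may cross 0
  without boundary terms.\<close>

lemma DERIV_subordination_weight:
  assumes "a > 0"
  shows "(subordination_weight c a has_real_derivative
    (c * subordination_weight (c - 1) a t + a * subordination_weight (c - 2) a t)) (at t)"
proof -
  consider "t > 0" | "t < 0" | "t = 0" by linarith
  then show ?thesis
  proof cases
    case 1
    have "((\<lambda>t. t powr c * exp (- a / t)) has_real_derivative
       (c * (t powr (c - 1) * exp (- a / t)) + a * (t powr (c - 2) * exp (- a / t)))) (at t)"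
      using 1 by (auto intro!: derivative_eq_intros simp: field_simps powr_diff power2_eq_square)
    then have "(subordination_weight c a has_real_derivative
       (c * (t powr (c - 1) * exp (- a / t)) + a * (t powr (c - 2) * exp (- a / t)))) (at t)"
      by (rule DERIV_cong_ev[THEN iffD1, rotated -1])
         (use 1 in \<open>auto simp: subordination_weight_def intro!: eventually_mono[OF eventually_nhds_in_open[of "{0<..}"]]\<close>)
    then show ?thesis using 1 by (simp add: subordination_weight_def)
  next
    case 2
    have "((\<lambda>t. 0) has_real_derivative 0) (at t)" by simp
    then have "(subordination_weight c a has_real_derivative 0) (at t)"
      by (rule DERIV_cong_ev[THEN iffD1, rotated -1])
         (use 2 in \<open>auto simp: subordination_weight_def intro!: eventually_mono[OF eventually_nhds_in_open[of "{..<0}"]]\<close>)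
    then show ?thesis using 2 by (simp add: subordination_weight_def)
  next
    case 3
    \<comment> \<open>The right difference quotient at 0 is again a weight, with exponent
      \<open>c - 1\<close>; the left one is identically 0.\<close>
    have "((\<lambda>h. subordination_weight c a h / h) \<longlongrightarrow> 0) (at_right 0)"
    proof (rule Lim_transform_eventually[OF tendsto_subordination_weight[OF assms, of "c-1"]])
      show "\<forall>\<^sub>F t in at_right 0. t powr (c - 1) * exp (- a / t) = subordination_weight c a t / t"
        by (rule eventually_at_right_less[THEN eventually_mono]) (simp add: subordination_weight_def powr_diff)
    qed
    moreover have "((\<lambda>h. subordination_weight c a h / h) \<longlongrightarrow> 0) (at_left 0)"
      by (rule tendsto_eventually) (auto simp: eventually_at_filter subordination_weight_def)
    ultimately have "((\<lambda>h. subordination_weight c a h / h) \<longlongrightarrow> 0) (at 0)"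
      by (simp add: filterlim_split_at)
    then show ?thesis using 3
      by (simp add: has_field_derivative_iff subordination_weight_def)
  qed
qed

lemma continuous_subordination_weight:
  assumes "a > 0"
  shows "continuous_on S (subordination_weight c a)"
  using DERIV_subordination_weight[OF assms]
  by (meson DERIV_continuous continuous_at_imp_continuous_on)

lemma subordination_weight_nonneg [simp]: "subordination_weight c a t \<ge> 0"
  by (simp add: subordination_weight_def)

lemma integrable_powr_at_top:
  fixes e :: real
  assumes "e < -1" "k > 0"
  shows "set_integrable lborel {k..} (\<lambda>t. t powr e)"
proof -
  have "(\<lambda>t. t powr e) absolutely_integrable_on {k..}"
    using has_integral_powr_to_inf[OF assms]
    by (intro nonnegative_absolutely_integrable_1) (auto simp: has_integral_iff)
  then show ?thesis
    unfolding set_integrable_def by (subst (asm) integrable_completion) auto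
qed

text \<open>Only infinity restricts \<open>c\<close>: on [0,1] the weight is continuous, and beyond
  1 the exponential is at most 1, which leaves the power \<open>t powr c\<close>.\<close>

lemma integrable_subordination_weight:
  assumes "a > 0" "c < -1"
  shows "integrable lborel (subordination_weight c a)"
proof -
  have 1: "set_integrable lborel {0..1} (subordination_weight c a)"
    by (intro borel_integrable_atLeastAtMost' continuous_subordination_weight assms)
  have meas [measurable]: "subordination_weight c a \<in> borel_measurable borel"
    using continuous_subordination_weight[OF assms(1), of UNIV c] by (rule borel_measurable_continuous_onI)
  have 2: "set_integrable lborel {1..} (subordination_weight c a)"
  proof (rule set_integrable_bound[OF integrable_powr_at_top[OF assms(2), of 1]])
    show "set_borel_measurable lborel {1..} (subordination_weight c a)"
      by (simp add: set_borel_measurable_def)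
  qed (use assms in \<open>auto simp: subordination_weight_def mult_left_le\<close>)
  have "set_integrable lborel ({0..1} \<union> {1..}) (subordination_weight c a)"
    using 1 2 by (rule set_integrable_Un) auto
  moreover have "(\<lambda>t. indicator ({0..1} \<union> {1..}) t *\<^sub>R subordination_weight c a t) = subordination_weight c a"
    by (auto simp: fun_eq_iff indicator_def subordination_weight_def)
  ultimately show ?thesis by (simp add: set_integrable_def)
qed

section \<open>Weighted L^1 estimates for translates of the weights\<close>

lemma borel_measurable_subordination_weight [measurable]:
  "subordination_weight c a \<in> borel_measurable borel"
  unfolding subordination_weight_def[abs_def] by measurable

lemma subordination_weight_mult_powr:
  "subordination_weight c a t * t powr d = subordination_weight (c + d) a t"
  by (simp add: subordination_weight_def powr_add)

lemma nn_integral_subordination_weight_finite: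
  assumes "a > 0" "c < -1"
  shows "(\<integral>\<^sup>+t. ennreal (subordination_weight c a t) \<partial>lborel) < \<infinity>"
  using integrable_subordination_weight[OF assms]
  by (simp add: integrable_iff_bounded)

text \<open>The translated weight lives on t > \<tau>, where t >= t - \<tau> > 0 and hence t^(-b) <=
  (t - \<tau>)^(-b). The power is thus absorbed into the exponent, and translation invariance gives
  a bound independent of \<tau>.\<close>

lemma nn_integral_subordination_weight_shift:
  assumes "\<tau> \<ge> 0" "b \<ge> 0"
  shows "(\<integral>\<^sup>+t. ennreal (subordination_weight c a (t - \<tau>)) * ennreal (t powr (- b)) \<partial>lborel)
     \<le> (\<integral>\<^sup>+t. ennreal (subordination_weight (c - b) a t) \<partial>lborel)"
proof -
  have "(\<integral>\<^sup>+t. ennreal (subordination_weight c a (t - \<tau>)) * ennreal (t powr (- b)) \<partial>lborel)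
     \<le> (\<integral>\<^sup>+t. ennreal (subordination_weight (c - b) a (t - \<tau>)) \<partial>lborel)"
  proof (rule nn_integral_mono)
    fix t :: real
    have "subordination_weight c a (t - \<tau>) * t powr (- b) \<le> subordination_weight (c - b) a (t - \<tau>)"
    proof (cases "t > \<tau>")
      case True
      have "t powr (- b) \<le> (t - \<tau>) powr (- b)"
        using True assms by (intro powr_mono2') auto
      then have "subordination_weight c a (t - \<tau>) * t powr (- b)
          \<le> subordination_weight c a (t - \<tau>) * (t - \<tau>) powr (- b)"
        by (rule mult_left_mono) simp
      then show ?thesis by (simp add: subordination_weight_mult_powr)
    qed (simp add: subordination_weight_def)
    then show "ennreal (subordination_weight c a (t - \<tau>)) * ennreal (t powr (- b))
        \<le> ennreal (subordination_weight (c - b) a (t - \<tau>))"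
      by (simp flip: ennreal_mult add: ennreal_leI)
  qed
  also have "\<dots> = (\<integral>\<^sup>+t. ennreal (subordination_weight (c - b) a t) \<partial>lborel)"
    by (subst nn_integral_real_affine[where c=1 and t="-\<tau>" and f="\<lambda>t. ennreal (subordination_weight (c - b) a t)"]) auto
  finally show ?thesis .
qed

text \<open>Fundamental theorem of calculus in the translation variable \<sigma>. The right side is
  kept as a nonnegative integral so that Tonelli applies when it is later integrated over
  \<open>t\<close>.\<close>

lemma subordination_weight_difference:
  assumes "a > 0" "\<tau> \<ge> 0"
  shows "ennreal \<bar>subordination_weight c a (t - \<tau>) - subordination_weight c a t\<bar>
    \<le> (\<integral>\<^sup>+\<sigma>. ennreal (\<bar>c\<bar> * subordination_weight (c - 1) a (t - \<sigma>)
             + a * subordination_weight (c - 2) a (t - \<sigma>)) * indicator {0..\<tau>} \<sigma> \<partial>lborel)"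
proof -
  define D where "D = (\<lambda>\<sigma>. - (c * subordination_weight (c - 1) a (t - \<sigma>)
             + a * subordination_weight (c - 2) a (t - \<sigma>)))"
  have der: "((\<lambda>\<sigma>. subordination_weight c a (t - \<sigma>)) has_real_derivative D \<sigma>) (at \<sigma>)" for \<sigma>
    unfolding D_def
    by (rule DERIV_chain2[OF DERIV_subordination_weight[OF assms(1)], THEN DERIV_cong])
       (auto intro!: derivative_eq_intros)
  have contD: "continuous_on S D" for S
    unfolding D_def
    by (intro continuous_intros continuous_on_compose2[OF continuous_subordination_weight[OF assms(1), of UNIV]]) auto
  have int: "integrable lborel (\<lambda>\<sigma>. D \<sigma> * indicator {0..\<tau>} \<sigma>)"
    using borel_integrable_atLeastAtMost'[OF contD] by (simp add: set_integrable_def mult.commute)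
  have "(\<integral>\<sigma>. D \<sigma> * indicator {0..\<tau>} \<sigma> \<partial>lborel)
      = subordination_weight c a (t - \<tau>) - subordination_weight c a (t - 0)"
    by (rule integral_FTC_Icc_real[OF assms(2)])
       (use der contD in \<open>auto intro: continuous_on_interior[of UNIV]\<close>)
  then have "ennreal \<bar>subordination_weight c a (t - \<tau>) - subordination_weight c a t\<bar>
     = ennreal (norm (\<integral>\<sigma>. D \<sigma> * indicator {0..\<tau>} \<sigma> \<partial>lborel))" by simp
  also have "\<dots> \<le> (\<integral>\<^sup>+\<sigma>. ennreal (norm (D \<sigma> * indicator {0..\<tau>} \<sigma>)) \<partial>lborel)"
    by (rule integral_norm_bound_ennreal[OF int])
  also have "\<dots> \<le> (\<integral>\<^sup>+\<sigma>. ennreal (\<bar>c\<bar> * subordination_weight (c - 1) a (t - \<sigma>)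
             + a * subordination_weight (c - 2) a (t - \<sigma>)) * indicator {0..\<tau>} \<sigma> \<partial>lborel)"
  proof (rule nn_integral_mono)
    fix \<sigma>
    have "\<bar>D \<sigma>\<bar> \<le> \<bar>c * subordination_weight (c - 1) a (t - \<sigma>)\<bar> + \<bar>a * subordination_weight (c - 2) a (t - \<sigma>)\<bar>"
      unfolding D_def by linarith
    also have "\<dots> = \<bar>c\<bar> * subordination_weight (c - 1) a (t - \<sigma>) + a * subordination_weight (c - 2) a (t - \<sigma>)"
      using assms by (simp add: abs_mult)
    finally show "ennreal (norm (D \<sigma> * indicator {0..\<tau>} \<sigma>)) \<le>
      ennreal (\<bar>c\<bar> * subordination_weight (c - 1) a (t - \<sigma>)
             + a * subordination_weight (c - 2) a (t - \<sigma>)) * indicator {0..\<tau>} \<sigma>"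
      by (auto simp: indicator_def intro!: ennreal_leI)
  qed
  finally show ?thesis .
qed

text \<open>The estimate for large \<tau>: the triangle inequality, and then the translation bound
  for each of the two terms.\<close>

lemma nn_integral_subordination_weight_difference_le:
  assumes "a > 0" "\<tau> \<ge> 0" "b \<ge> 0"
  shows "(\<integral>\<^sup>+t. ennreal \<bar>subordination_weight c a (t - \<tau>) - subordination_weight c a t\<bar> * ennreal (t powr (- b)) \<partial>lborel)
    \<le> 2 * (\<integral>\<^sup>+t. ennreal (subordination_weight (c - b) a t) \<partial>lborel)"
proof -
  \<comment> \<open>The form \<open>t - 0\<close> makes the second term an instance of the
    translation bound with zero shift.\<close>
  have "(\<integral>\<^sup>+t. ennreal \<bar>subordination_weight c a (t - \<tau>) - subordination_weight c a t\<bar> * ennreal (t powr (- b)) \<partial>lborel)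
    \<le> (\<integral>\<^sup>+t. ennreal (subordination_weight c a (t - \<tau>)) * ennreal (t powr (- b))
           + ennreal (subordination_weight c a (t - 0)) * ennreal (t powr (- b)) \<partial>lborel)"
  proof (rule nn_integral_mono)
    fix t
    have "\<bar>subordination_weight c a (t - \<tau>) - subordination_weight c a t\<bar>
       \<le> subordination_weight c a (t - \<tau>) + subordination_weight c a t"
      using subordination_weight_nonneg[of c a "t - \<tau>"] subordination_weight_nonneg[of c a t] by linarith
    then show "ennreal \<bar>subordination_weight c a (t - \<tau>) - subordination_weight c a t\<bar> * ennreal (t powr (- b))
       \<le> ennreal (subordination_weight c a (t - \<tau>)) * ennreal (t powr (- b))
           + ennreal (subordination_weight c a (t - 0)) * ennreal (t powr (- b))"
      by (simp flip: ennreal_mult ennreal_plus distrib_right add: ennreal_leI mult_right_mono)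
  qed
  also have "\<dots> = (\<integral>\<^sup>+t. ennreal (subordination_weight c a (t - \<tau>)) * ennreal (t powr (- b)) \<partial>lborel)
      + (\<integral>\<^sup>+t. ennreal (subordination_weight c a (t - 0)) * ennreal (t powr (- b)) \<partial>lborel)"
    by (rule nn_integral_add) auto
  also have "\<dots> \<le> (\<integral>\<^sup>+t. ennreal (subordination_weight (c - b) a t) \<partial>lborel)
      + (\<integral>\<^sup>+t. ennreal (subordination_weight (c - b) a t) \<partial>lborel)"
    using assms by (intro add_mono nn_integral_subordination_weight_shift) auto
  finally show ?thesis by (simp add: mult_2)
qed

text \<open>The estimate for small \<tau>: after Tonelli, the inner integral over \<open>t\<close>
  is bounded uniformly in \<sigma> by the translation bound, and the factor \<tau> is the length of
  the interval of \<sigma>.\<close>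

lemma nn_integral_subordination_weight_difference_le_linear:
  assumes "a > 0" "\<tau> \<ge> 0" "b \<ge> 0"
  shows "(\<integral>\<^sup>+t. ennreal \<bar>subordination_weight c a (t - \<tau>) - subordination_weight c a t\<bar> * ennreal (t powr (- b)) \<partial>lborel)
    \<le> ennreal \<tau> * (ennreal \<bar>c\<bar> * (\<integral>\<^sup>+t. ennreal (subordination_weight (c - 1 - b) a t) \<partial>lborel)
          + ennreal a * (\<integral>\<^sup>+t. ennreal (subordination_weight (c - 2 - b) a t) \<partial>lborel))"
    (is "_ \<le> _ * ?M")
proof -
  let ?D = "\<lambda>t. \<bar>c\<bar> * subordination_weight (c - 1) a t + a * subordination_weight (c - 2) a t"
  have "(\<integral>\<^sup>+t. ennreal \<bar>subordination_weight c a (t - \<tau>) - subordination_weight c a t\<bar> * ennreal (t powr (- b)) \<partial>lborel)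
    \<le> (\<integral>\<^sup>+t. (\<integral>\<^sup>+\<sigma>. ennreal (?D (t - \<sigma>)) * indicator {0..\<tau>} \<sigma> \<partial>lborel) * ennreal (t powr (- b)) \<partial>lborel)"
    by (intro nn_integral_mono mult_right_mono subordination_weight_difference assms) auto
  also have "\<dots> = (\<integral>\<^sup>+t. (\<integral>\<^sup>+\<sigma>. ennreal (?D (t - \<sigma>)) * indicator {0..\<tau>} \<sigma> * ennreal (t powr (- b)) \<partial>lborel) \<partial>lborel)"
    by (subst nn_integral_multc) auto
  also have "\<dots> = (\<integral>\<^sup>+\<sigma>. (\<integral>\<^sup>+t. ennreal (?D (t - \<sigma>)) * indicator {0..\<tau>} \<sigma> * ennreal (t powr (- b)) \<partial>lborel) \<partial>lborel)"
    by (rule lborel_pair.Fubini') measurable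
  also have "\<dots> \<le> (\<integral>\<^sup>+\<sigma>. ?M * indicator {0..\<tau>} \<sigma> \<partial>lborel)"
  proof (rule nn_integral_mono)
    fix \<sigma> :: real
    show "(\<integral>\<^sup>+t. ennreal (?D (t - \<sigma>)) * indicator {0..\<tau>} \<sigma> * ennreal (t powr (- b)) \<partial>lborel) \<le> ?M * indicator {0..\<tau>} \<sigma>"
    proof (cases "\<sigma> \<in> {0..\<tau>}")
      case True
      then have "\<sigma> \<ge> 0" by simp
      have "(\<integral>\<^sup>+t. ennreal (?D (t - \<sigma>)) * indicator {0..\<tau>} \<sigma> * ennreal (t powr (- b)) \<partial>lborel)
        = (\<integral>\<^sup>+t. ennreal \<bar>c\<bar> * (ennreal (subordination_weight (c - 1) a (t - \<sigma>)) * ennreal (t powr (- b)))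
              + ennreal a * (ennreal (subordination_weight (c - 2) a (t - \<sigma>)) * ennreal (t powr (- b))) \<partial>lborel)"
        using True assms
        by (intro nn_integral_cong) (simp flip: ennreal_mult ennreal_plus add: algebra_simps)
      also have "\<dots> = ennreal \<bar>c\<bar> * (\<integral>\<^sup>+t. (ennreal (subordination_weight (c - 1) a (t - \<sigma>)) * ennreal (t powr (- b))) \<partial>lborel)
          + ennreal a * (\<integral>\<^sup>+t. (ennreal (subordination_weight (c - 2) a (t - \<sigma>)) * ennreal (t powr (- b))) \<partial>lborel)"
        by (subst nn_integral_add) (auto simp: nn_integral_cmult)
      also have "\<dots> \<le> ?M"
        using assms \<open>\<sigma> \<ge> 0\<close>
        by (intro add_mono mult_left_mono nn_integral_subordination_weight_shift) auto
      finally show ?thesis using True by simp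
    qed simp
  qed
  also have "\<dots> = ennreal \<tau> * ?M"
    using assms by (subst nn_integral_cmult_indicator) (auto simp: mult.commute)
  finally show ?thesis .
qed

section \<open>Explicit integrals on half-lines and the Marchaud kernel\<close>

lemma set_integrable_lborel_iff:
  fixes f :: "real \<Rightarrow> real"
  assumes "set_borel_measurable borel S f"
  shows "set_integrable lborel S f \<longleftrightarrow> f absolutely_integrable_on S"
  using assms unfolding set_integrable_def set_borel_measurable_def
  by (subst integrable_completion) auto

lemma integrable_powr_at_zero:
  fixes e :: real
  assumes "e > -1" "k \<ge> 0"
  shows "set_integrable lborel {0..k} (\<lambda>t. t powr e)"
proof (subst set_integrable_lborel_iff)
  show "(\<lambda>t. t powr e) absolutely_integrable_on {0..k}"
    using has_integral_powr_from_0[OF assms]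
    by (intro nonnegative_absolutely_integrable_1) (auto simp: has_integral_iff)
qed (auto simp: set_borel_measurable_def)

lemma Gamma_integral_scaled:
  fixes s a :: real
  assumes "s > 0" "a > 0"
  shows "set_integrable lborel {0<..} (\<lambda>v. v powr (s - 1) * exp (- (a * v)))"
    and "(LINT v:{0<..}|lborel. v powr (s - 1) * exp (- (a * v))) = Gamma s * a powr (- s)"
proof -
  let ?f = "\<lambda>v. indicator {0<..} v * (v powr (s - 1) * exp (- v))"
  have ai: "(\<lambda>t. t powr (s - 1) / exp t) absolutely_integrable_on {0..}"
    using Gamma_integral_real[OF assms(1)]
    by (intro nonnegative_absolutely_integrable_1) (auto simp: has_integral_iff)
  then have si: "set_integrable lborel {0..} (\<lambda>t. t powr (s - 1) / exp t)"
    by (subst set_integrable_lborel_iff) (auto simp: set_borel_measurable_def)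
  have eq: "(\<lambda>v. indicator {0..} v *\<^sub>R (v powr (s - 1) / exp v)) = ?f"
    using assms by (auto simp: fun_eq_iff indicator_def exp_minus field_simps)
  have "has_bochner_integral lborel ?f (Gamma s)"
    using si set_borel_integral_eq_integral(2)[OF si] Gamma_integral_real[OF assms(1)]
    unfolding set_integrable_def set_lebesgue_integral_def eq
    by (simp add: has_bochner_integral_iff has_integral_iff)
  then have "has_bochner_integral lborel (\<lambda>v. ?f (0 + a * v)) (Gamma s / a)"
    using assms by (subst (asm) lborel_has_bochner_integral_real_affine_iff[of a _ _ 0]) (auto simp: field_simps)
  then have "has_bochner_integral lborel (\<lambda>v. a powr (1 - s) * ?f (0 + a * v)) (a powr (1 - s) * (Gamma s / a))"
    by (rule has_bochner_integral_mult_right)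
  moreover have "(\<lambda>v. a powr (1 - s) * ?f (0 + a * v)) = (\<lambda>v. indicator {0<..} v *\<^sub>R (v powr (s - 1) * exp (- (a * v))))"
    using assms by (auto simp: fun_eq_iff indicator_def zero_less_mult_iff powr_mult powr_diff field_simps)
  moreover have "a powr (1 - s) * (Gamma s / a) = Gamma s * a powr (- s)"
    using assms by (simp add: powr_diff powr_minus field_simps)
  ultimately have "has_bochner_integral lborel (\<lambda>v. indicator {0<..} v *\<^sub>R (v powr (s - 1) * exp (- (a * v)))) (Gamma s * a powr (- s))"
    by simp
  then show "set_integrable lborel {0<..} (\<lambda>v. v powr (s - 1) * exp (- (a * v)))"
    and "(LINT v:{0<..}|lborel. v powr (s - 1) * exp (- (a * v))) = Gamma s * a powr (- s)"
    unfolding set_integrable_def set_lebesgue_integral_def by (simp_all add: has_bochner_integral_iff)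
qed

text \<open>The inner integral over \<open>t\<close> is \<open>O(\<tau>)\<close> for small \<open>\<tau>\<close>, by the mean value estimate, and bounded for large
  \<open>\<tau>\<close>; this matches the singularity \<open>\<tau>\<^bsup>-1-s\<^esup>\<close> at both ends.\<close>

lemma integrable_marchaud_kernel:
  fixes a b s :: real
  assumes "0 < a" "0 < s" "s < 1" "s < b"
  shows "integrable (lborel \<Otimes>\<^sub>M lborel) (\<lambda>(\<tau>, t). indicator {0<..} \<tau> * \<tau> powr (-1 - s)
     * (subordination_weight (s - 1) a (t - \<tau>) - subordination_weight (s - 1) a t) * t powr (- b))"
proof (rule integrableI_bounded)
  define M where "M = (\<integral>\<^sup>+t. ennreal (subordination_weight (s - 1 - b) a t) \<partial>lborel)"
  define M' where "M' = ennreal \<bar>s - 1\<bar> * (\<integral>\<^sup>+t. ennreal (subordination_weight (s - 1 - 1 - b) a t) \<partial>lborel)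
          + ennreal a * (\<integral>\<^sup>+t. ennreal (subordination_weight (s - 1 - 2 - b) a t) \<partial>lborel)"
  \<comment> \<open>Here s < b enters: the largest exponent involved is s - 1 - b, which must lie
    below -1.\<close>
  have M: "M < \<infinity>" "M' < \<infinity>"
    using assms nn_integral_subordination_weight_finite[OF assms(1)]
    unfolding M_def M'_def by (auto simp: ennreal_mult_less_top)
  let ?w = "subordination_weight (s - 1) a"
  have "(\<integral>\<^sup>+x. ennreal (norm (case x of (\<tau>, t) \<Rightarrow> indicator {0<..} \<tau> * \<tau> powr (-1 - s)
     * (?w (t - \<tau>) - ?w t) * t powr (- b))) \<partial>(lborel \<Otimes>\<^sub>M lborel))
     = (\<integral>\<^sup>+\<tau>. \<integral>\<^sup>+t. ennreal (norm (indicator {0<..} \<tau> * \<tau> powr (-1 - s)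
     * (?w (t - \<tau>) - ?w t) * t powr (- b))) \<partial>lborel \<partial>lborel)"
    by (subst lborel.nn_integral_fst[symmetric]) auto
  also have "\<dots> = (\<integral>\<^sup>+\<tau>. ennreal (indicator {0<..} \<tau> * \<tau> powr (-1 - s)) *
      (\<integral>\<^sup>+t. ennreal \<bar>?w (t - \<tau>) - ?w t\<bar> * ennreal (t powr (- b)) \<partial>lborel) \<partial>lborel)"
    by (subst nn_integral_cmult[symmetric])
       (auto simp: abs_mult ennreal_mult mult.assoc intro!: nn_integral_cong)
  \<comment> \<open>On [0,1] the linear bound improves \<tau>^(-1-s) to \<tau>^(-s), integrable
    since s < 1; on [1,\<infinity>) the power \<tau>^(-1-s) is integrable since s > 0.\<close>
  also have "\<dots> \<le> (\<integral>\<^sup>+\<tau>. ennreal (norm (indicator {0..1} \<tau> *\<^sub>R \<tau> powr (- s))) * M'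
      + ennreal (norm (indicator {1..} \<tau> *\<^sub>R \<tau> powr (-1 - s))) * (2 * M) \<partial>lborel)"
  proof (rule nn_integral_mono)
    fix \<tau> :: real
    let ?I = "\<integral>\<^sup>+t. ennreal \<bar>?w (t - \<tau>) - ?w t\<bar> * ennreal (t powr (- b)) \<partial>lborel"
    consider "\<tau> \<le> 0" | "0 < \<tau>" "\<tau> \<le> 1" | "\<tau> > 1" by linarith
    then show "ennreal (indicator {0<..} \<tau> * \<tau> powr (-1 - s)) * ?I
       \<le> ennreal (norm (indicator {0..1} \<tau> *\<^sub>R \<tau> powr (- s))) * M'
      + ennreal (norm (indicator {1..} \<tau> *\<^sub>R \<tau> powr (-1 - s))) * (2 * M)"
    proof cases
      case 2
      have "ennreal (\<tau> powr (-1 - s)) * ?I \<le> ennreal (\<tau> powr (-1 - s)) * (ennreal \<tau> * M')"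
        unfolding M'_def using 2 assms
        by (intro mult_left_mono nn_integral_subordination_weight_difference_le_linear) auto
      also have "\<dots> = ennreal (\<tau> powr (- s)) * M'"
        using 2 by (simp flip: ennreal_mult mult.assoc add: powr_diff powr_minus field_simps)
      finally show ?thesis using 2 by (simp add: add_increasing2)
    next
      case 3
      have "ennreal (\<tau> powr (-1 - s)) * ?I \<le> ennreal (\<tau> powr (-1 - s)) * (2 * M)"
        unfolding M_def using 3 assms
        by (intro mult_left_mono nn_integral_subordination_weight_difference_le) auto
      then show ?thesis using 3 by (simp add: add_increasing)
    qed simp
  qed
  also have "\<dots> = (\<integral>\<^sup>+\<tau>. ennreal (norm (indicator {0..1} \<tau> *\<^sub>R \<tau> powr (- s))) \<partial>lborel) * M'
      + (\<integral>\<^sup>+\<tau>. ennreal (norm (indicator {1..} \<tau> *\<^sub>R \<tau> powr (-1 - s))) \<partial>lborel) * (2 * M)"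
    by (subst nn_integral_add) (auto simp: nn_integral_multc)
  also have "\<dots> < \<infinity>"
  proof -
    have "(\<integral>\<^sup>+\<tau>. ennreal (norm (indicator {0..1} \<tau> *\<^sub>R \<tau> powr (- s))) \<partial>lborel) < \<infinity>"
      using integrable_powr_at_zero[of "- s" 1] assms
      unfolding set_integrable_def integrable_iff_bounded by simp
    moreover have "(\<integral>\<^sup>+\<tau>. ennreal (norm (indicator {1..} \<tau> *\<^sub>R \<tau> powr (-1 - s))) \<partial>lborel) < \<infinity>"
      using integrable_powr_at_top[of "-1 - s" 1] assms
      unfolding set_integrable_def integrable_iff_bounded by simp
    ultimately show ?thesis
      using M by (auto simp: ennreal_mult_less_top)
  qed
  finally show "(\<integral>\<^sup>+x. ennreal (norm (case x of (\<tau>, t) \<Rightarrow> indicator {0<..} \<tau> * \<tau> powr (-1 - s)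
     * (?w (t - \<tau>) - ?w t) * t powr (- b))) \<partial>(lborel \<Otimes>\<^sub>M lborel)) < \<infinity>" .
qed simp

section \<open>The Marchaud derivative\<close>

text \<open>Neither half of the difference is integrable at 0 separately, so they are treated
  together. Adding a/s times the integrand of Gamma(1 - s) amounts to an integration by parts and
  makes the sum an exact derivative.\<close>

lemma marchaud_substitution_integral:
  fixes a s t :: real
  assumes "a > 0" "0 < s" "s < 1" "t > 0"
    and int: "set_integrable lborel {0<..} (\<lambda>v. v powr (-1 - s) * (exp (- (a * v)) - (1 + t * v) powr (s - 1)))"
  shows "(LINT v:{0<..}|lborel. v powr (-1 - s) * (exp (- (a * v)) - (1 + t * v) powr (s - 1)))
     = t powr s / s - Gamma (1 - s) * a powr s / s"
proof -
  let ?N = "\<lambda>v. v powr (-1 - s) * (exp (- (a * v)) - (1 + t * v) powr (s - 1))"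
  let ?G = "\<lambda>v. v powr (1 - s - 1) * exp (- (a * v))"
  \<comment> \<open>The first term is an antiderivative of -v^(-1-s) (1 + t v)^(s-1), because (1/v +
    t)^(s-1) / v^2 equals that power product. Differentiating the second gives the exponential part
    plus the added Gamma integrand.\<close>
  define H where "H = (\<lambda>v. ((1 / v + t) powr s - v powr (- s) * exp (- (a * v))) / s)"
  define h where "h = (\<lambda>v. ?N v + a / s * ?G v)"
  have G: "set_integrable lborel {0<..} ?G" "(LINT v:{0<..}|lborel. ?G v) = Gamma (1 - s) * a powr (s - 1)"
    using Gamma_integral_scaled[of "1 - s" a] assms by auto
  have hint: "set_integrable lborel {0<..} h"
    unfolding h_def by (intro set_integral_add(1) int set_integrable_mult_right G)
  have ein: "einterval 0 \<infinity> = {0<..}" by (auto simp: einterval_def)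
  have "(LBINT v=0..\<infinity>. h v) = t powr s / s - 0"
  proof (rule interval_integral_FTC_integrable[where F = H])
    fix v :: real assume "0 < ereal v"
    then have v: "v > 0" by simp
    have eq: "1 / v + t = (1 + t * v) / v" using v by (simp add: field_simps)
    have "(H has_real_derivative (s * (1 / v + t) powr (s - 1) * (- (1 / v^2))
       - (v powr (- s) * (exp (- (a * v)) * - a) + - s * v powr (- s - 1) * exp (- (a * v)))) / s) (at v)"
      unfolding H_def using v assms
      by (auto intro!: derivative_eq_intros simp: add_pos_pos power2_eq_square)
    also have "(s * (1 / v + t) powr (s - 1) * (- (1 / v^2))
       - (v powr (- s) * (exp (- (a * v)) * - a) + - s * v powr (- s - 1) * exp (- (a * v)))) / s = h v"
    proof -
      have p1: "(1 / v + t) powr (s - 1) * (1 / v^2) = (1 + t * v) powr (s - 1) * v powr (-1 - s)"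
        using v assms unfolding eq
        by (simp add: powr_divide powr_diff powr_minus powr_add field_simps power2_eq_square)
      have p2: "1 - s - 1 = - s" "- s - 1 = -1 - s"
        by simp_all
      show ?thesis
        unfolding h_def p2 using p1 assms by (simp add: field_simps)
    qed
    finally show "(H has_vector_derivative h v) (at v)"
      by (simp add: has_real_derivative_iff_has_vector_derivative)
    show "isCont h v"
    proof -
      have "1 + t * v \<noteq> 0" using v assms(4) by (smt (verit) mult_pos_pos)
      then show ?thesis
        unfolding h_def using v assms(2) by (intro continuous_intros) simp_all
    qed
  next
    show "set_integrable lborel (einterval 0 \<infinity>) h" by (simp add: ein hint)
    \<comment> \<open>Both terms of \<open>H\<close> blow up like v^(-s) at 0; they cancel up to
      order v^(1-s).\<close>
    have "(H \<longlongrightarrow> 0) (at_right 0)"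
      unfolding H_def using assms by real_asymp
    then show "((H \<circ> real_of_ereal) \<longlongrightarrow> 0) (at_right 0)"
      by (simp add: zero_ereal_def ereal_tendsto_simps)
    have "((\<lambda>v. (1 / v + t) powr s - v powr (- s) * exp (- (a * v))) \<longlongrightarrow> t powr s) at_top"
      using assms(1-4) by real_asymp
    then have "(H \<longlongrightarrow> t powr s / s) at_top"
      unfolding H_def by (rule tendsto_divide[OF _ tendsto_const]) (use assms in simp)
    then show "((H \<circ> real_of_ereal) \<longlongrightarrow> t powr s / s) (at_left \<infinity>)"
      by (simp add: ereal_tendsto_simps)
  qed simp
  then have "(LINT v:{0<..}|lborel. h v) = t powr s / s"
    by (simp add: interval_lebesgue_integral_def ein)
  moreover have "(LINT v:{0<..}|lborel. h v) = (LINT v:{0<..}|lborel. ?N v) + a / s * (LINT v:{0<..}|lborel. ?G v)"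
    unfolding h_def by (simp only: set_integral_add(2)[OF int set_integrable_mult_right[OF G(1)]] set_integral_mult_right)
  moreover have "a / s * (Gamma (1 - s) * a powr (s - 1)) = Gamma (1 - s) * a powr s / s"
    using assms by (simp add: powr_diff field_simps)
  ultimately show ?thesis unfolding G(2) by linarith
qed

text \<open>The integral is split at \<tau> = t. The tail contributes -K t^s / s, the part below t
  contributes K (t^s / s - Gamma(1 - s) a^s / s), and the terms in t^s cancel. The common factor
  \<open>K\<close> is the weight of exponent -1 - s at t.\<close>

lemma marchaud_subordination_weight:
  fixes a s t :: real
  assumes "a > 0" "0 < s" "s < 1" "t > 0"
    and int: "set_integrable lborel {0<..} (\<lambda>\<tau>. \<tau> powr (-1 - s)
        * (subordination_weight (s - 1) a (t - \<tau>) - subordination_weight (s - 1) a t))"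
  shows "(LINT \<tau>:{0<..}|lborel. \<tau> powr (-1 - s)
        * (subordination_weight (s - 1) a (t - \<tau>) - subordination_weight (s - 1) a t))
     = - (Gamma (1 - s) / s) * a powr s * subordination_weight (- 1 - s) a t"
proof -
  let ?w = "subordination_weight (s - 1) a"
  let ?f = "\<lambda>\<tau>. \<tau> powr (-1 - s) * (?w (t - \<tau>) - ?w t)"
  let ?N = "\<lambda>v. v powr (-1 - s) * (exp (- (a * v)) - (1 + t * v) powr (s - 1))"
  define K where "K = t powr (-1 - s) * exp (- a / t)"
  have K: "K > 0" using assms by (simp add: K_def)
  have split: "{0<..} = {0<..<t} \<union> {t..}" using assms by auto
  have int1: "set_integrable lborel {0<..<t} ?f" and int2: "set_integrable lborel {t..} ?f"
    using assms by (auto intro: set_integrable_subset[OF int])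
  have "(LINT \<tau>:{0<..}|lborel. ?f \<tau>) = (LINT \<tau>:{0<..<t}|lborel. ?f \<tau>) + (LINT \<tau>:{t..}|lborel. ?f \<tau>)"
    unfolding split by (rule set_integral_Un) (use int1 int2 in auto)
  \<comment> \<open>For \<tau> >= t the argument t - \<tau> is not positive, so only the term with
    \<open>?w t\<close> survives.\<close>
  also have "(LINT \<tau>:{t..}|lborel. ?f \<tau>) = (LINT \<tau>:{t..}|lborel. - ?w t * \<tau> powr (-1 - s))"
    by (rule set_lebesgue_integral_cong) (auto simp: subordination_weight_def)
  also have "\<dots> = - ?w t * (LINT \<tau>:{t..}|lborel. \<tau> powr (-1 - s))"
    by (rule set_integral_mult_right)
  also have "(LINT \<tau>:{t..}|lborel. \<tau> powr (-1 - s)) = t powr (- s) / s"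
    using has_integral_powr_to_inf[of "-1 - s" t] assms integrable_powr_at_top[of "-1 - s" t]
    by (simp add: set_borel_integral_eq_integral(2) has_integral_iff)
  also have "- ?w t * (t powr (- s) / s) = - K * t powr s / s"
    using assms by (simp add: subordination_weight_def K_def powr_diff powr_minus field_simps)
  also have "(LINT \<tau>:{0<..<t}|lborel. ?f \<tau>) = K * (t powr s / s - Gamma (1 - s) * a powr s / s)"
  proof -
    \<comment> \<open>the substitution is \<open>1 / (t - \<tau>) = 1 / t + v\<close>, which separates the exponential of \<open>w (t - \<tau>)\<close>\<close>
    define \<gamma> where "\<gamma> = (\<lambda>v. t - t / (1 + t * v))"
    define \<gamma>' where "\<gamma>' = (\<lambda>v. t\<^sup>2 / (1 + t * v)\<^sup>2)"
    have pos: "1 + t * v > 0" if "v > 0" for v using that assms by (simp add: add_pos_pos)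
    have der: "(\<gamma> has_field_derivative \<gamma>' v) (at v within {0<..})" if "v \<in> {0<..}" for v
      unfolding \<gamma>_def \<gamma>'_def using pos[of v] that assms
      by (auto intro!: derivative_eq_intros simp: power2_eq_square)
    have inj: "inj_on \<gamma> {0<..}"
    proof (rule inj_onI)
      fix x y assume xy: "x \<in> {0<..}" "y \<in> {0<..}" "\<gamma> x = \<gamma> y"
      then have "t / (1 + t * x) = t / (1 + t * y)" by (simp add: \<gamma>_def)
      then show "x = y" using pos[of x] pos[of y] xy assms by (simp add: frac_eq_eq)
    qed
    have img: "\<gamma> ` {0<..} = {0<..<t}"
    proof (intro set_eqI iffI)
      fix x assume "x \<in> \<gamma> ` {0<..}"
      then obtain v where "v > 0" "x = \<gamma> v" by auto
      moreover have "1 < 1 + t * v" using \<open>v > 0\<close> assms(4) by simp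
      then have "t / (1 + t * v) < t / 1"
        using assms(4) by (intro divide_strict_left_mono) auto
      moreover have "0 < t / (1 + t * v)"
        using pos[OF \<open>v > 0\<close>] assms(4) by simp
      ultimately show "x \<in> {0<..<t}" by (simp add: \<gamma>_def)
    next
      fix x assume x: "x \<in> {0<..<t}"
      then have "1 / (t - x) - 1 / t > 0"
        by (simp add: frac_less2)
      moreover have "1 + t * (1 / (t - x) - 1 / t) = t / (t - x)"
        using x by (simp add: field_simps)
      then have "x = \<gamma> (1 / (t - x) - 1 / t)"
        using x by (simp add: \<gamma>_def)
      ultimately show "x \<in> \<gamma> ` {0<..}" by blast
    qed
    have eq: "\<bar>\<gamma>' v\<bar> *\<^sub>R ?f (\<gamma> v) = K * ?N v" if "v \<in> {0<..}" for v
    proof -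
      \<comment> \<open>In terms of q, the variable \<tau> is t^2 v / q, its complement t - \<tau>
        is t / q, and the Jacobian is t^2 / q^2. The powers of q cancel in front of exp(-a v), and
        the other term keeps q^(s-1).\<close>
      define q where "q = 1 + t * v"
      have v: "v > 0" using that by simp
      have q: "q > 0" using pos[OF v] by (simp add: q_def)
      have g: "\<gamma> v = t\<^sup>2 * v / q" "t - \<gamma> v = t / q"
        using q by (auto simp: \<gamma>_def q_def[symmetric] field_simps power2_eq_square)
           (simp add: q_def algebra_simps)
      have w1: "?w (t - \<gamma> v) = t powr (s - 1) * exp (- a / t) * (q powr (1 - s) * exp (- (a * v)))"
      proof -
        have "- a / (t / q) = - a / t + - (a * v)"
          using assms q by (simp add: q_def field_simps)
        then have "exp (- a / (t / q)) = exp (- a / t) * exp (- (a * v))"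
          by (simp only: exp_add)
        moreover have "(t / q) powr (s - 1) = t powr (s - 1) * q powr (1 - s)"
          using assms q by (simp add: powr_divide powr_diff field_simps)
        ultimately show ?thesis
          using assms(4) q unfolding g(2) by (simp add: subordination_weight_def)
      qed
      have w2: "?w t = t powr (s - 1) * exp (- a / t)"
        using assms by (simp add: subordination_weight_def)
      have gp: "\<gamma> v powr (-1 - s) = t powr (- 2 - 2 * s) * v powr (-1 - s) * q powr (1 + s)"
      proof -
        have "(t\<^sup>2) powr (-1 - s) = t powr (- 2 - 2 * s)"
          using assms by (simp add: powr_powr flip: powr_numeral)
        moreover have "q powr (1 + s) = 1 / q powr (-1 - s)"
          using powr_minus_divide[of q "-1 - s"] by (simp add: add.commute)
        ultimately show ?thesis unfolding g using assms v q by (simp add: powr_mult powr_divide)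
      qed
      have qq: "\<bar>\<gamma>' v\<bar> = t powr 2 * q powr (-2)"
        using assms q by (simp add: \<gamma>'_def q_def[symmetric] powr_minus field_simps)
      have tt: "t powr 2 * t powr (- 2 - 2 * s) * t powr (s - 1) = t powr (-1 - s)"
      proof -
        have "2 + (- 2 - 2 * s) + (s - 1) = -1 - s" by simp
        then show ?thesis by (simp only: powr_add[symmetric])
      qed
      have q1: "q powr (-2) * q powr (1 + s) * q powr (1 - s) = 1"
        using q by (simp flip: powr_add)
      have q2: "q powr (-2) * q powr (1 + s) = q powr (s - 1)"
        by (simp flip: powr_add)
      have "\<bar>\<gamma>' v\<bar> *\<^sub>R ?f (\<gamma> v) = (t powr 2 * t powr (- 2 - 2 * s) * t powr (s - 1)) * exp (- a / t) * v powr (-1 - s)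
         * ((q powr (-2) * q powr (1 + s) * q powr (1 - s)) * exp (- (a * v)) - q powr (-2) * q powr (1 + s))"
        unfolding w1 w2 gp qq by (simp add: algebra_simps)
      also have "\<dots> = K * ?N v"
        unfolding tt q1 unfolding q2 K_def q_def[symmetric] by simp
      finally show ?thesis .
    qed
    have ai: "?f absolutely_integrable_on \<gamma> ` {0<..}"
      using int1 unfolding img
      by (subst set_integrable_lborel_iff[symmetric]) (auto simp: set_borel_measurable_def)
    \<comment> \<open>The change of variables carries over integrability as well as the value, which
      supplies the integrability hypothesis of \<open>marchaud_substitution_integral\<close> without
      estimating \<open>?N\<close> near 0.\<close>
    have "(\<lambda>v. \<bar>\<gamma>' v\<bar> *\<^sub>R ?f (\<gamma> v)) absolutely_integrable_on {0<..} \<and>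
        integral {0<..} (\<lambda>v. \<bar>\<gamma>' v\<bar> *\<^sub>R ?f (\<gamma> v)) = integral {0<..<t} ?f"
      using ai img
      by (subst has_absolute_integral_change_of_variables_real[OF _ der inj]) auto
    moreover have "((\<lambda>v. \<bar>\<gamma>' v\<bar> *\<^sub>R ?f (\<gamma> v)) absolutely_integrable_on {0<..}) \<longleftrightarrow> ((\<lambda>v. K * ?N v) absolutely_integrable_on {0<..})"
      by (rule set_integrable_cong[OF refl refl eq])
    moreover have "integral {0<..} (\<lambda>v. \<bar>\<gamma>' v\<bar> *\<^sub>R ?f (\<gamma> v)) = integral {0<..} (\<lambda>v. K * ?N v)"
      by (rule integral_cong) (rule eq)
    ultimately have *: "(\<lambda>v. K * ?N v) absolutely_integrable_on {0<..}"
        "integral {0<..} (\<lambda>v. K * ?N v) = integral {0<..<t} ?f" by auto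
    have KN: "set_integrable lborel {0<..} (\<lambda>v. K * ?N v)"
      using * by (subst set_integrable_lborel_iff) (auto simp: set_borel_measurable_def)
    then have N: "set_integrable lborel {0<..} ?N" using K by simp
    have "(LINT \<tau>:{0<..<t}|lborel. ?f \<tau>) = (LINT v:{0<..}|lborel. K * ?N v)"
      using *(2) set_borel_integral_eq_integral(2)[OF KN] set_borel_integral_eq_integral(2)[OF int1] by simp
    also have "\<dots> = K * (LINT v:{0<..}|lborel. ?N v)" by simp
    finally show ?thesis
      using marchaud_substitution_integral[OF assms(1-4) N] by simp
  qed
  finally have "(LINT \<tau>:{0<..}|lborel. ?f \<tau>) = - (Gamma (1 - s) / s) * a powr s * K"
    by (simp add: algebra_simps)
  then show ?thesis using assms by (simp add: subordination_weight_def K_def)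
qed

text \<open>Makes the integrals with and without time shift finite separately, so that their
  difference can be written as a single integral.\<close>

lemma integrable_subordination_weight_shift:
  fixes \<psi> :: "real \<Rightarrow> real"
  assumes "a > 0" "b \<ge> 0" "c - b < -1" "\<tau> \<ge> 0"
    and [measurable]: "\<psi> \<in> borel_measurable borel"
    and bound: "\<And>t. t > 0 \<Longrightarrow> \<bar>\<psi> t\<bar> \<le> K * t powr (- b)"
  shows "integrable lborel (\<lambda>t. subordination_weight c a (t - \<tau>) * \<psi> t)"
proof (rule Bochner_Integration.integrable_bound)
  have "(\<integral>\<^sup>+t. ennreal (subordination_weight c a (t - \<tau>)) * ennreal (t powr (- b)) \<partial>lborel) < \<infinity>"
    using nn_integral_subordination_weight_shift[OF assms(4,2), of c a]
      nn_integral_subordination_weight_finite[OF assms(1,3)] by (rule le_less_trans)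
  then have "integrable lborel (\<lambda>t. subordination_weight c a (t - \<tau>) * t powr (- b))"
    by (intro integrableI_bounded) (auto simp: ennreal_mult abs_mult)
  then show "integrable lborel (\<lambda>t. K * (subordination_weight c a (t - \<tau>) * t powr (- b)))"
    by simp
  show "AE t in lborel. norm (subordination_weight c a (t - \<tau>) * \<psi> t)
      \<le> norm (K * (subordination_weight c a (t - \<tau>) * t powr (- b)))"
  proof (rule AE_I2)
    fix t
    show "norm (subordination_weight c a (t - \<tau>) * \<psi> t)
      \<le> norm (K * (subordination_weight c a (t - \<tau>) * t powr (- b)))"
    proof (cases "t > \<tau>")
      case True
      then have "\<bar>\<psi> t\<bar> \<le> \<bar>K\<bar> * t powr (- b)"
        using bound[of t] assms(4) by (smt (verit) mult_right_mono powr_ge_zero)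
      then have "subordination_weight c a (t - \<tau>) * \<bar>\<psi> t\<bar>
         \<le> subordination_weight c a (t - \<tau>) * (\<bar>K\<bar> * t powr (- b))"
        by (rule mult_left_mono) simp
      then show ?thesis by (simp add: abs_mult algebra_simps)
    qed (simp add: subordination_weight_def)
  qed
qed measurable

text \<open>The one-variable core, free of the group: \<phi> stands for p(g,e,t) as a function of
  time. Fubini exchanges \<tau> and t, after which the inner integral is the Marchaud integral of
  the weight.\<close>

lemma fractional_power_of_subordination:
  fixes \<phi> :: "real \<Rightarrow> real"
  assumes "a > 0" "0 < s" "s < 1" "s < b"
    and meas: "(\<lambda>t. indicator {0<..} t * \<phi> t) \<in> borel_measurable borel"
    and bound: "\<And>t. t > 0 \<Longrightarrow> \<bar>\<phi> t\<bar> \<le> K * t powr (- b)"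
  shows "(LINT \<tau>:{0<..}|lborel. \<tau> powr (-1 - s) *
       ((LINT t:{0<..}|lborel. subordination_weight (s - 1) a t * \<phi> (t + \<tau>))
        - (LINT t:{0<..}|lborel. subordination_weight (s - 1) a t * \<phi> t)))
     = - (Gamma (1 - s) / s) * a powr s * (LINT t:{0<..}|lborel. subordination_weight (-1 - s) a t * \<phi> t)"
proof -
  let ?w = "subordination_weight (s - 1) a"
  define \<psi> where "\<psi> t = indicator {0<..} t * \<phi> t" for t
  have [measurable]: "\<psi> \<in> borel_measurable borel"
    using meas unfolding \<psi>_def[abs_def] .
  have bound': "\<bar>\<psi> t\<bar> \<le> K * t powr (- b)" if "t > 0" for t
    using bound[OF that] that by (simp add: \<psi>_def)
  have \<psi>0: "\<psi> t = 0" if "t \<le> 0" for t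
    using that by (simp add: \<psi>_def)
  \<comment> \<open>Translation invariance of Lebesgue measure moves the time shift from \<phi> to
    the weight. With both factors extended by zero, the integrals run over the whole line and need
    no adjusted limits.\<close>
  have eq\<psi>: "(LINT t:{0<..}|lborel. subordination_weight c a t * \<phi> (t + \<tau>))
      = (\<integral>t. subordination_weight c a (t - \<tau>) * \<psi> t \<partial>lborel)" if "\<tau> \<ge> 0" for c \<tau>
  proof -
    have "(LINT t:{0<..}|lborel. subordination_weight c a t * \<phi> (t + \<tau>))
      = (\<integral>t. subordination_weight c a t * \<psi> (t + \<tau>) \<partial>lborel)"
      unfolding set_lebesgue_integral_def
      by (rule Bochner_Integration.integral_cong)
         (use that in \<open>auto simp: \<psi>_def indicator_def subordination_weight_def\<close>)
    also have "\<dots> = (\<integral>t. subordination_weight c a (t - \<tau>) * \<psi> t \<partial>lborel)"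
      using lborel_integral_real_affine[of 1 "\<lambda>t. subordination_weight c a t * \<psi> (t + \<tau>)" "- \<tau>"]
      by (simp add: algebra_simps)
    finally show ?thesis .
  qed
  let ?F = "\<lambda>\<tau> t. indicator {0<..} \<tau> * \<tau> powr (-1 - s) * (?w (t - \<tau>) - ?w t) * \<psi> t"
  let ?B = "\<lambda>\<tau> t. indicator {0<..} \<tau> * \<tau> powr (-1 - s) * (?w (t - \<tau>) - ?w t) * t powr (- b)"
  have F0: "integrable (lborel \<Otimes>\<^sub>M lborel) (\<lambda>(\<tau>, t). ?B \<tau> t)"
    using integrable_marchaud_kernel[OF assms(1-4)] .
  have F: "integrable (lborel \<Otimes>\<^sub>M lborel) (\<lambda>(\<tau>, t). ?F \<tau> t)"
  proof (rule Bochner_Integration.integrable_bound)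
    show "integrable (lborel \<Otimes>\<^sub>M lborel) (\<lambda>x. K * (case x of (\<tau>, t) \<Rightarrow> ?B \<tau> t))"
      using F0 by (rule integrable_mult_right)
    show "AE x in lborel \<Otimes>\<^sub>M lborel. norm (case x of (\<tau>, t) \<Rightarrow> ?F \<tau> t) \<le> norm (K * (case x of (\<tau>, t) \<Rightarrow> ?B \<tau> t))"
    proof (intro AE_I2, clarify)
      fix \<tau> t :: real
      have "\<bar>\<psi> t\<bar> \<le> \<bar>K\<bar> * t powr (- b)"
      proof (cases "t > 0")
        case True
        then show ?thesis using bound'[of t] by (smt (verit) mult_right_mono powr_ge_zero)
      qed (simp add: \<psi>0)
      then have "\<bar>indicator {0<..} \<tau> * \<tau> powr (-1 - s) * (?w (t - \<tau>) - ?w t)\<bar> * \<bar>\<psi> t\<bar>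
         \<le> \<bar>indicator {0<..} \<tau> * \<tau> powr (-1 - s) * (?w (t - \<tau>) - ?w t)\<bar> * (\<bar>K\<bar> * t powr (- b))"
        by (rule mult_left_mono) simp
      moreover have "norm (?F \<tau> t) = \<bar>indicator {0<..} \<tau> * \<tau> powr (-1 - s) * (?w (t - \<tau>) - ?w t)\<bar> * \<bar>\<psi> t\<bar>"
        by (simp add: abs_mult)
      moreover have "norm (K * ?B \<tau> t) = \<bar>indicator {0<..} \<tau> * \<tau> powr (-1 - s) * (?w (t - \<tau>) - ?w t)\<bar> * (\<bar>K\<bar> * t powr (- b))"
        by (simp add: abs_mult)
      ultimately show "norm (?F \<tau> t) \<le> norm (K * ?B \<tau> t)"
        by (simp only:)
    qed
  qed measurable
  have "(LINT \<tau>:{0<..}|lborel. \<tau> powr (-1 - s) *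
       ((LINT t:{0<..}|lborel. ?w t * \<phi> (t + \<tau>)) - (LINT t:{0<..}|lborel. ?w t * \<phi> t)))
     = (\<integral>\<tau>. \<integral>t. ?F \<tau> t \<partial>lborel \<partial>lborel)"
    unfolding set_lebesgue_integral_def[of lborel "{0<..}" "\<lambda>\<tau>. \<tau> powr (-1 - s) * _ \<tau>"]
  proof (rule Bochner_Integration.integral_cong[OF refl])
    fix \<tau> :: real
    show "indicat_real {0<..} \<tau> *\<^sub>R (\<tau> powr (-1 - s) *
       ((LINT t:{0<..}|lborel. ?w t * \<phi> (t + \<tau>)) - (LINT t:{0<..}|lborel. ?w t * \<phi> t)))
       = (\<integral>t. ?F \<tau> t \<partial>lborel)"
    proof (cases "\<tau> > 0")
      case True
      have "(LINT t:{0<..}|lborel. ?w t * \<phi> (t + \<tau>)) - (LINT t:{0<..}|lborel. ?w t * \<phi> t)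
         = (\<integral>t. ?w (t - \<tau>) * \<psi> t \<partial>lborel) - (\<integral>t. ?w (t - 0) * \<psi> t \<partial>lborel)"
        using eq\<psi>[of \<tau> "s - 1"] eq\<psi>[of 0 "s - 1"] True by simp
      also have "\<dots> = (\<integral>t. ?w (t - \<tau>) * \<psi> t - ?w (t - 0) * \<psi> t \<partial>lborel)"
        by (rule Bochner_Integration.integral_diff[symmetric];
            rule integrable_subordination_weight_shift[where b=b and K=K])
           (use assms True bound' in auto)
      finally show ?thesis
        using True by (simp flip: integral_mult_right_zero) (simp add: algebra_simps)
    qed simp
  qed
  also have "\<dots> = (\<integral>t. \<integral>\<tau>. ?F \<tau> t \<partial>lborel \<partial>lborel)"
    by (rule lborel_pair.Fubini_integral[OF F, symmetric])
  also have "\<dots> = (\<integral>t. - (Gamma (1 - s) / s) * a powr s * (subordination_weight (- 1 - s) a (t - 0) * \<psi> t) \<partial>lborel)"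
  proof (rule integral_cong_AE)
    \<comment> \<open>Fubini gives integrability in \<tau> for almost every t. It is read off from
      the dominating \<open>?B\<close>, whose factor t^(-b) is invertible for t > 0, whereas \<psi>
      may vanish.\<close>
    show "AE t in lborel. (\<integral>\<tau>. ?F \<tau> t \<partial>lborel)
        = - (Gamma (1 - s) / s) * a powr s * (subordination_weight (- 1 - s) a (t - 0) * \<psi> t)"
      using lborel_pair.AE_integrable_snd[OF F0]
    proof eventually_elim
      case (elim t)
      show ?case
      proof (cases "t > 0")
        case True
        have "integrable lborel (\<lambda>\<tau>. ?B \<tau> t * t powr b)"
          using elim by (rule integrable_mult_left)
        then have int: "set_integrable lborel {0<..} (\<lambda>\<tau>. \<tau> powr (-1 - s) * (?w (t - \<tau>) - ?w t))"
          using True unfolding set_integrable_def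
          by (simp add: mult.assoc flip: powr_add)
        have "(\<integral>\<tau>. ?F \<tau> t \<partial>lborel) = (LINT \<tau>:{0<..}|lborel. \<tau> powr (-1 - s) * (?w (t - \<tau>) - ?w t)) * \<psi> t"
          unfolding set_lebesgue_integral_def by (simp add: mult.assoc flip: integral_mult_left_zero)
        also have "\<dots> = - (Gamma (1 - s) / s) * a powr s * subordination_weight (-1 - s) a t * \<psi> t"
          using marchaud_subordination_weight[OF assms(1-3) True int] by simp
        finally show ?thesis by simp
      qed (simp add: \<psi>0)
    qed
  qed measurable
  also have "\<dots> = - (Gamma (1 - s) / s) * a powr s * (\<integral>t. subordination_weight (- 1 - s) a (t - 0) * \<psi> t \<partial>lborel)"
    by (rule integral_mult_right_zero)
  also have "(\<integral>t. subordination_weight (- 1 - s) a (t - 0) * \<psi> t \<partial>lborel)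
      = (LINT t:{0<..}|lborel. subordination_weight (-1 - s) a t * \<phi> t)"
    using eq\<psi>[of 0 "-1 - s"] by simp
  finally show ?thesis .
qed

section \<open>The Chapman-Kolmogorov identity\<close>

text \<open>Supplies the sigma-finiteness that Fubini requires of the Haar measure, with the heat
  kernel at time 1 as the positive function. The sets where q >= 1/n exhaust the space and have
  finite measure by Markov's inequality.\<close>

lemma sigma_finite_measure_if_integrable_pos:
  fixes q :: "'b \<Rightarrow> real"
  assumes int: "integrable M q" and pos: "\<And>x. x \<in> space M \<Longrightarrow> q x > 0"
  shows "sigma_finite_measure M"
proof
  have [measurable]: "q \<in> borel_measurable M" using int by auto
  let ?A = "\<lambda>n::nat. {x \<in> space M. 1 \<le> ennreal (real n) * ennreal (q x)}"
  have "emeasure M (?A n) \<noteq> \<infinity>" for n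
  proof -
    have "emeasure M (?A n) \<le> ennreal (real n) * (\<integral>\<^sup>+x. ennreal (q x) * indicator (space M) x \<partial>M)"
      by (rule nn_integral_Markov_inequality) auto
    also have "\<dots> = ennreal (real n) * (\<integral>\<^sup>+x. ennreal (q x) \<partial>M)"
      by (auto intro!: arg_cong2[where f="(*)"] nn_integral_cong)
    also have "\<dots> < \<infinity>"
      using int pos by (subst nn_integral_eq_integral) (auto simp: less_imp_le ennreal_mult_less_top)
    finally show ?thesis by simp
  qed
  moreover have "(\<Union>n. ?A n) = space M"
  proof safe
    fix x assume x: "x \<in> space M"
    obtain n where "1 / q x < real n" using reals_Archimedean2 by blast
    then have "1 \<le> real n * q x" using pos[OF x] by (simp add: field_simps)
    then have "1 \<le> ennreal (real n) * ennreal (q x)"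
      using pos[OF x] by (simp flip: ennreal_mult' ennreal_1 add: ennreal_leI del: ennreal_1)
    then show "x \<in> (\<Union>n. ?A n)" using x by auto
  qed
  moreover have "?A n \<in> sets M" for n by measurable
  ultimately show "\<exists>A. countable A \<and> A \<subseteq> sets M \<and> \<Union> A = space M \<and> (\<forall>a\<in>A. emeasure M a \<noteq> \<infinity>)"
    by (intro exI[of _ "range ?A"]) auto
qed

text \<open>If a nonempty open set were null, so would be all its left translates; by Lindelof
  countably many of them cover the group, contradicting that the measure is nonzero.\<close>

lemma haar_measure_open_pos:
  fixes \<mu> :: "'g::{topological_group_add, second_countable_topology} measure"
  assumes "haar_measure \<mu>" "open U" "x \<in> U"
  shows "emeasure \<mu> U \<noteq> 0"
proof
  assume null: "emeasure \<mu> U = 0"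
  have sets: "sets \<mu> = sets borel" and inv: "\<And>g. distr \<mu> borel ((+) g) = \<mu>"
    and nz: "emeasure \<mu> UNIV \<noteq> 0"
    using assms(1) by (auto simp: haar_measure_def)
  have meas: "(+) g \<in> measurable \<mu> borel" for g
    unfolding measurable_cong_sets[OF sets refl]
    by (intro borel_measurable_continuous_onI continuous_intros)
  let ?T = "\<lambda>g. (+) g -` U"
  have opn: "open (?T g)" for g
    by (intro open_vimage assms continuous_intros)
  have "?T g \<in> null_sets \<mu>" for g
  proof
    have "emeasure \<mu> U = emeasure (distr \<mu> borel ((+) g)) U" by (simp add: inv)
    also have "\<dots> = emeasure \<mu> (?T g \<inter> space \<mu>)"
      using assms by (intro emeasure_distr meas) auto
    finally show "emeasure \<mu> (?T g) = 0"
      using null sets_eq_imp_space_eq[OF sets] by simp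
  qed (use opn sets in auto)
  moreover obtain F where F: "F \<subseteq> range ?T" "countable F" "\<Union>F = \<Union>(range ?T)"
    using Lindelof[of "range ?T"] opn by blast
  ultimately have "(\<Union>S\<in>F. S) \<in> null_sets \<mu>"
    by (intro null_sets_UN') auto
  moreover have "(\<Union>S\<in>F. S) = UNIV"
  proof -
    \<comment> \<open>The group is written additively but is not commutative; (x - h) + h = x holds
      in this order.\<close>
    have "h \<in> ?T (x - h)" for h using assms by simp
    then have "\<Union>F = UNIV" unfolding F(3) by blast
    then show ?thesis by simp
  qed
  ultimately show False using nz by auto
qed

text \<open>A tent function in a chart around \<open>x\<close>, extended by zero. A continuous test
  function suffices, since the semigroup law is stated on \<open>C0\<close>.\<close>

lemma smooth_atlas_bump:
  fixes A :: "('g::t2_space, 'a::euclidean_space) atlas"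
  assumes "smooth_atlas A" "open W" "x \<in> W"
  obtains f :: "'g \<Rightarrow> real" where "f \<in> C0" "\<And>z. f z \<ge> 0" "f x > 0" "\<And>z. f z \<noteq> 0 \<Longrightarrow> z \<in> W"
proof -
  have "x \<in> \<Union> (fst ` A)"
    and charts: "\<forall>(U, \<phi>)\<in>A. open U \<and> open (\<phi> ` U) \<and> homeomorphism U (\<phi> ` U) \<phi> (inv_into U \<phi>)"
    using assms(1) by (simp_all add: smooth_atlas_def)
  then obtain U \<phi> where U: "(U, \<phi>) \<in> A" "x \<in> U" by auto
  then have opU: "open U" and op: "open (\<phi> ` U)" and hom: "homeomorphism U (\<phi> ` U) \<phi> (inv_into U \<phi>)"
    using charts by auto
  have "openin (top_of_set (\<phi> ` U)) (\<phi> ` (U \<inter> W))"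
    using hom by (rule homeomorphism_imp_open_map) (use assms opU in \<open>auto simp: openin_open_Int\<close>)
  then have "open (\<phi> ` (U \<inter> W))" using op by (rule openin_open_trans)
  moreover have "\<phi> x \<in> \<phi> ` (U \<inter> W)" using U assms by auto
  ultimately obtain r where r: "r > 0" "cball (\<phi> x) r \<subseteq> \<phi> ` (U \<inter> W)"
    by (metis open_contains_cball)
  define K where "K = inv_into U \<phi> ` cball (\<phi> x) r"
  define f where "f z = (if z \<in> U then max 0 (r - dist (\<phi> z) (\<phi> x)) else 0)" for z
  have inv: "inv_into U \<phi> (\<phi> z) = z" if "z \<in> U" for z
    using hom that by (auto simp: homeomorphism_def)
  have contU: "continuous_on U \<phi>" using hom by (simp add: homeomorphism_def)
  have "compact K"
    unfolding K_def
    by (rule compact_continuous_image[OF continuous_on_subset[of "\<phi> ` U"]])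
       (use hom r in \<open>auto simp: homeomorphism_def\<close>)
  have fK: "z \<in> K" if "f z \<noteq> 0" for z
    using that inv[of z] unfolding K_def f_def
    by (auto simp: max_def dist_commute split: if_splits intro!: image_eqI[of _ _ "\<phi> z"])
  have KW: "K \<subseteq> U \<inter> W"
    unfolding K_def using r(2) inv by auto
  \<comment> \<open>Continuity is glued from two open sets: the chart domain, and the complement of
    \<open>K\<close>, where f vanishes. \<open>K\<close> is closed because it is compact in a
    Hausdorff space.\<close>
  have "continuous_on (U \<union> - K) f"
  proof (rule continuous_on_open_Un)
    have "continuous_on U (\<lambda>z. max 0 (r - dist (\<phi> z) (\<phi> x)))"
      by (intro continuous_intros contU)
    then show "continuous_on U f" by (rule continuous_on_eq) (simp add: f_def)
    show "continuous_on (- K) f"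
      by (rule continuous_on_eq[OF continuous_on_const[of _ 0]]) (use fK in auto)
  qed (use opU \<open>compact K\<close> in \<open>auto intro: compact_imp_closed\<close>)
  then have "continuous_on UNIV f"
    by (rule continuous_on_subset) (use KW in auto)
  moreover have "\<exists>K. compact K \<and> (\<forall>z. z \<notin> K \<longrightarrow> \<bar>f z\<bar> < \<epsilon>)" if "\<epsilon> > 0" for \<epsilon>
    using \<open>compact K\<close> fK that by (intro exI[of _ K]) force
  ultimately have "f \<in> C0" by (simp add: C0_def)
  then show ?thesis
  proof (rule that)
    show "f x > 0" using U r by (simp add: f_def)
    show "z \<in> W" if "f z \<noteq> 0" for z using fK[OF that] KW by auto
  qed (simp add: f_def)
qed

lemma C0_bounded:
  assumes "f \<in> C0"
  obtains B where "B \<ge> 0" "\<And>x. \<bar>f x\<bar> \<le> B"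
proof -
  obtain K where K: "compact K" "\<And>x. x \<notin> K \<Longrightarrow> \<bar>f x\<bar> < 1"
    using assms by (auto simp: C0_def dest: spec[of _ 1])
  have "compact (f ` K)"
    using assms K by (intro compact_continuous_image) (auto simp: C0_def intro: continuous_on_subset)
  then obtain b where b: "\<And>x. x \<in> K \<Longrightarrow> \<bar>f x\<bar> \<le> b"
    using compact_imp_bounded by (fastforce simp: bounded_iff)
  show ?thesis
  proof (rule that)
    show "\<bar>f x\<bar> \<le> max 1 b" for x
      using b[of x] K(2)[of x] by linarith
  qed simp
qed

lemma heat_kernel_sections:
  fixes A :: "('g::{topological_group_add, t2_space, second_countable_topology}, 'a::euclidean_space) atlas"
  assumes "heat_kernel A T E \<mu> p"
  shows "t > 0 \<Longrightarrow> continuous_on S (\<lambda>h. p h k t)"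
    and "t > 0 \<Longrightarrow> continuous_on S (\<lambda>k. p h k t)"
    and "t > 0 \<Longrightarrow> continuous_on S' (\<lambda>(h, k). p h k t)"
    and "continuous_on {0<..} (\<lambda>t. p h k t)"
    and "continuous_on (UNIV \<times> {0<..}) (\<lambda>(h, t). p h k t)"
proof -
  have c: "continuous_on (UNIV \<times> UNIV \<times> {0<..}) (\<lambda>(g, g', t). p g g' t)"
    using assms by (simp add: heat_kernel_def)
  have comp: "continuous_on S (\<lambda>x. p (u x) (v x) (w x))"
    if "continuous_on S u" "continuous_on S v" "continuous_on S w" "\<And>x. x \<in> S \<Longrightarrow> w x > 0"
    for S :: "'z::topological_space set" and u v w
  proof -
    have "continuous_on S (\<lambda>x. (u x, v x, w x))"
      by (intro continuous_on_Pair that)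
    from continuous_on_compose2[OF c this] show ?thesis using that(4) by auto
  qed
  show "t > 0 \<Longrightarrow> continuous_on S (\<lambda>h. p h k t)"
    "t > 0 \<Longrightarrow> continuous_on S (\<lambda>k. p h k t)"
    "continuous_on {0<..} (\<lambda>t. p h k t)"
    by (auto intro!: comp continuous_intros)
  show "t > 0 \<Longrightarrow> continuous_on S' (\<lambda>(h, k). p h k t)"
    "continuous_on (UNIV \<times> {0<..}) (\<lambda>(h, t). p h k t)"
    unfolding case_prod_unfold by (auto intro!: comp continuous_intros)
qed

text \<open>The bound \<open>K t\<close> is uniform in both space variables, so it can be pulled out
  of integrals against the probability density p(g,.,t). In the main proof it is C^(-1)
  t^(-Q/2).\<close>

locale bounded_heat_kernel =
  fixes A :: "('g::{topological_group_add, t2_space, second_countable_topology}, 'a::euclidean_space) atlas"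
    and T E \<mu> p and K :: "real \<Rightarrow> real"
  assumes atlas: "smooth_atlas A" and haar: "haar_measure \<mu>"
    and kernel: "heat_kernel A T E \<mu> p"
    and stochastically_complete: "t > 0 \<Longrightarrow> kernel_operator \<mu> p t (\<lambda>_. 1) h = 1"
    and kernel_bound: "t > 0 \<Longrightarrow> p h k t \<le> K t"
begin

lemma sets_mu [measurable_cong]: "sets \<mu> = sets borel"
  using haar by (simp add: haar_measure_def)

lemma space_mu [simp]: "space \<mu> = UNIV"
  using sets_eq_imp_space_eq[OF sets_mu] by simp

lemma p_pos: "t > 0 \<Longrightarrow> p h k t > 0"
  using kernel by (simp add: heat_kernel_def)

lemma measurable_p [measurable]:
  "t > 0 \<Longrightarrow> (\<lambda>h. p h k t) \<in> borel_measurable borel"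
  "t > 0 \<Longrightarrow> (\<lambda>k. p h k t) \<in> borel_measurable borel"
  using heat_kernel_sections(1,2)[OF kernel] by (auto intro: borel_measurable_continuous_onI)

lemma measurable_p_pair:
  "t > 0 \<Longrightarrow> (\<lambda>(h, k). p h k t) \<in> borel_measurable (borel \<Otimes>\<^sub>M borel)"
  using heat_kernel_sections(3)[OF kernel] unfolding borel_prod by (auto intro: borel_measurable_continuous_onI)

lemma integrable_p: assumes "t > 0" shows "integrable \<mu> (\<lambda>k. p h k t)"
  \<comment> \<open>A non-integrable function has integral 0 by convention, so the value 1 forces
    integrability.\<close>
  using stochastically_complete[OF assms, of h] not_integrable_integral_eq
  unfolding kernel_operator_def by fastforce

lemma integral_p: "t > 0 \<Longrightarrow> (\<integral>k. p h k t \<partial>\<mu>) = 1"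
  using stochastically_complete by (simp add: kernel_operator_def)

sublocale sigma_finite_measure \<mu>
  by (rule sigma_finite_measure_if_integrable_pos[OF integrable_p[OF zero_less_one]]) (simp add: p_pos)

sublocale mu_pair: pair_sigma_finite \<mu> \<mu> ..

sublocale mu_lborel: pair_sigma_finite \<mu> "lborel :: real measure" ..

text \<open>Dominated convergence with majorant p(g,h,\<tau>) K(t); sequences suffice because the
  group is second countable.\<close>

lemma convolution_continuous:
  assumes "\<tau> > 0" "t > 0"
  shows "continuous_on UNIV (\<lambda>k. \<integral>h. p g h \<tau> * p h k t \<partial>\<mu>)"
  unfolding continuous_on_eq_continuous_within
proof (intro ballI continuous_within_sequentiallyI)
  fix k :: 'g and u :: "nat \<Rightarrow> 'g" assume u: "u \<longlonglongrightarrow> k"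
  show "(\<lambda>n. \<integral>h. p g h \<tau> * p h (u n) t \<partial>\<mu>) \<longlonglongrightarrow> (\<integral>h. p g h \<tau> * p h k t \<partial>\<mu>)"
  proof (rule integral_dominated_convergence)
    show "integrable \<mu> (\<lambda>h. p g h \<tau> * K t)" using integrable_p[OF assms(1)] by simp
    show "AE h in \<mu>. (\<lambda>n. p g h \<tau> * p h (u n) t) \<longlonglongrightarrow> p g h \<tau> * p h k t"
      using heat_kernel_sections(2)[OF kernel assms(2), of UNIV] u
      by (intro AE_I2 tendsto_mult tendsto_const continuous_on_tendsto_compose[of UNIV "\<lambda>k. p _ k t"]) auto
    show "AE h in \<mu>. norm (p g h \<tau> * p h (u n) t) \<le> p g h \<tau> * K t" for n
      using assms p_pos kernel_bound
      by (intro AE_I2) (auto simp: abs_mult less_imp_le intro!: mult_left_mono)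
    show "(\<lambda>h. p g h \<tau> * p h k t) \<in> borel_measurable \<mu>" using assms by measurable
    show "(\<lambda>h. p g h \<tau> * p h (u n) t) \<in> borel_measurable \<mu>" for n using assms by measurable
  qed
qed

text \<open>The function p(.,k,t) is not known to lie in \<open>C0\<close>, so the semigroup law
  cannot be applied to it directly. It is applied to \<open>f\<close> instead, and Fubini, justified
  by unit mass and the boundedness of \<open>f\<close>, transfers it to the kernels.\<close>

lemma convolution_weak:
  assumes "\<tau> > 0" "t > 0" "f \<in> C0"
  shows "integrable \<mu> (\<lambda>k. (\<integral>h. p g h \<tau> * p h k t \<partial>\<mu>) * f k)"
    and "(\<integral>k. (\<integral>h. p g h \<tau> * p h k t \<partial>\<mu>) * f k \<partial>\<mu>) = (\<integral>k. p g k (\<tau> + t) * f k \<partial>\<mu>)"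
proof -
  have semi: "C0_semigroup (kernel_operator \<mu> p)"
    and int: "\<And>t f g. t > 0 \<Longrightarrow> f \<in> C0 \<Longrightarrow> integrable \<mu> (\<lambda>k. p g k t * f k)"
    using kernel by (auto simp: heat_kernel_def heat_semigroup_def)
  have [measurable]: "f \<in> borel_measurable borel"
    using assms(3) by (auto simp: C0_def intro: borel_measurable_continuous_onI)
  note [measurable] = measurable_p_pair[OF assms(2)]
  obtain B where B: "B \<ge> 0" "\<And>x. \<bar>f x\<bar> \<le> B" using C0_bounded[OF assms(3)] by blast
  have meas: "(\<lambda>(h, k). p g h \<tau> * p h k t * f k) \<in> borel_measurable (\<mu> \<Otimes>\<^sub>M \<mu>)"
    using assms by (simp add: case_prod_unfold) measurable
  have pair: "integrable (\<mu> \<Otimes>\<^sub>M \<mu>) (\<lambda>(h, k). p g h \<tau> * p h k t * f k)"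
  proof (rule mu_pair.Fubini_integrable[OF meas])
    show "AE h in \<mu>. integrable \<mu> (\<lambda>k. case (h, k) of (h, k) \<Rightarrow> p g h \<tau> * p h k t * f k)"
      using int[OF assms(2,3)] by (intro AE_I2) (simp add: mult.assoc)
    show "integrable \<mu> (\<lambda>h. \<integral>k. norm (case (h, k) of (h, k) \<Rightarrow> p g h \<tau> * p h k t * f k) \<partial>\<mu>)"
    proof (rule Bochner_Integration.integrable_bound)
      show "integrable \<mu> (\<lambda>h. p g h \<tau> * B)" using integrable_p[OF assms(1)] by simp
      show "AE h in \<mu>. norm (\<integral>k. norm (case (h, k) of (h, k) \<Rightarrow> p g h \<tau> * p h k t * f k) \<partial>\<mu>) \<le> norm (p g h \<tau> * B)"
      proof (rule AE_I2)
        fix h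
        have "(\<integral>k. \<bar>p h k t * f k\<bar> \<partial>\<mu>) \<le> (\<integral>k. p h k t * B \<partial>\<mu>)"
        proof (rule integral_mono)
          show "integrable \<mu> (\<lambda>k. \<bar>p h k t * f k\<bar>)"
            by (intro integrable_abs int assms)
          show "integrable \<mu> (\<lambda>k. p h k t * B)"
            using integrable_p[OF assms(2)] by simp
          show "\<bar>p h k t * f k\<bar> \<le> p h k t * B" for k
            using p_pos[OF assms(2), of h k] B(2)[of k]
            by (auto simp: abs_mult less_imp_le intro!: mult_left_mono)
        qed
        also have "\<dots> = B" using integral_p[OF assms(2)] by simp
        finally have "p g h \<tau> * (\<integral>k. \<bar>p h k t * f k\<bar> \<partial>\<mu>) \<le> p g h \<tau> * B"
          using p_pos[OF assms(1)] by (intro mult_left_mono) (auto simp: less_imp_le)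
        moreover have "(\<integral>k. norm (case (h, k) of (h, k) \<Rightarrow> p g h \<tau> * p h k t * f k) \<partial>\<mu>)
           = p g h \<tau> * (\<integral>k. \<bar>p h k t * f k\<bar> \<partial>\<mu>)"
          using p_pos[OF assms(1)]
          by (subst integral_mult_right_zero[symmetric]) (auto simp: abs_mult less_imp_le mult.assoc)
        ultimately show "norm (\<integral>k. norm (case (h, k) of (h, k) \<Rightarrow> p g h \<tau> * p h k t * f k) \<partial>\<mu>) \<le> norm (p g h \<tau> * B)"
          using B p_pos[OF assms(1)] by (simp add: abs_mult less_imp_le)
      qed
    qed (use meas in measurable)
  qed
  have eq: "(\<integral>h. p g h \<tau> * p h k t * f k \<partial>\<mu>) = (\<integral>h. p g h \<tau> * p h k t \<partial>\<mu>) * f k" for k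
    by simp
  show "integrable \<mu> (\<lambda>k. (\<integral>h. p g h \<tau> * p h k t \<partial>\<mu>) * f k)"
    using mu_pair.integrable_snd[OF pair] by (simp only: eq)
  have "(\<integral>k. (\<integral>h. p g h \<tau> * p h k t \<partial>\<mu>) * f k \<partial>\<mu>) = (\<integral>h. \<integral>k. p g h \<tau> * p h k t * f k \<partial>\<mu> \<partial>\<mu>)"
    using mu_pair.Fubini_integral[OF pair] by (simp only: eq)
  also have "\<dots> = kernel_operator \<mu> p \<tau> (kernel_operator \<mu> p t f) g"
    by (simp add: kernel_operator_def mult.assoc)
  also have "\<dots> = kernel_operator \<mu> p (\<tau> + t) f g"
    using semi assms by (simp add: C0_semigroup_def)
  finally show "(\<integral>k. (\<integral>h. p g h \<tau> * p h k t \<partial>\<mu>) * f k \<partial>\<mu>) = (\<integral>k. p g k (\<tau> + t) * f k \<partial>\<mu>)"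
    by (simp add: kernel_operator_def)
qed

text \<open>The semigroup law exhibits both sides as continuous densities of the same functional on \<open>C0\<close>,
  hence pointwise and not only almost everywhere.\<close>

lemma chapman_kolmogorov:
  assumes "\<tau> > 0" "t > 0"
  shows "(\<integral>h. p g h \<tau> * p h k t \<partial>\<mu>) = p g k (\<tau> + t)"
proof (rule ccontr)
  let ?B = "\<lambda>k. \<integral>h. p g h \<tau> * p h k t \<partial>\<mu>" and ?A = "\<lambda>k. p g k (\<tau> + t)"
  assume ne: "?B k \<noteq> ?A k"
  \<comment> \<open>The sign treats both possible inequalities at once: on the open neighbourhood
    \<open>W\<close> of \<open>k\<close> the signed defect is strictly positive. Tested against a
    bump supported in \<open>W\<close> it integrates to 0, so the nonempty open set where the bump
    is positive would be null.\<close>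
  define d where "d = sgn (?B k - ?A k)"
  define W where "W = {z. d * (?B z - ?A z) > 0}"
  have "continuous_on UNIV (\<lambda>z. d * (?B z - ?A z))"
    using assms by (intro continuous_intros convolution_continuous heat_kernel_sections[OF kernel]) auto
  then have "open W" unfolding W_def by (intro open_Collect_less continuous_on_const)
  moreover have "k \<in> W" using ne by (simp add: W_def d_def sgn_if)
  ultimately obtain f where f: "f \<in> C0" "\<And>z. f z \<ge> 0" "f k > 0" "\<And>z. f z \<noteq> 0 \<Longrightarrow> z \<in> W"
    using smooth_atlas_bump[OF atlas] by metis
  have iA: "integrable \<mu> (\<lambda>z. ?A z * f z)"
    using kernel f assms by (auto simp: heat_kernel_def)
  have int: "integrable \<mu> (\<lambda>z. d * (?B z * f z - ?A z * f z))"
    by (intro integrable_mult_right Bochner_Integration.integrable_diff iA convolution_weak(1) assms f)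
  have zero: "(\<integral>z. d * (?B z * f z - ?A z * f z) \<partial>\<mu>) = 0"
    using convolution_weak[OF assms f(1)] iA by simp
  have fac: "d * (?B z * f z - ?A z * f z) = (d * (?B z - ?A z)) * f z" for z
    by (simp add: algebra_simps)
  have nonneg: "0 \<le> d * (?B z * f z - ?A z * f z)" for z
    unfolding fac using f(2)[of z] f(4)[of z] by (cases "f z = 0") (auto simp: W_def)
  have "AE z in \<mu>. d * (?B z * f z - ?A z * f z) = 0"
    using zero integral_nonneg_eq_0_iff_AE[OF int AE_I2[OF nonneg]] by (simp only:)
  then have "AE z in \<mu>. \<not> f z > 0"
  proof eventually_elim
    case (elim z)
    then show ?case unfolding fac using f(4)[of z] by (auto simp: W_def)
  qed
  moreover have op: "open {z. f z > 0}"
    using f(1) by (intro open_Collect_less) (auto simp: C0_def)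
  ultimately have "emeasure \<mu> {z. f z > 0} = 0"
    using AE_iff_null[of \<mu> "\<lambda>z. \<not> f z > 0"] sets_mu by auto
  then show False using haar_measure_open_pos[OF haar op, of k] f(3) by simp
qed

text \<open>The operator is a plain integral, so it may be applied to a superposition of kernels
  without placing that function in \<open>C0\<close>. Unit mass in \<open>h\<close> and
  integrability of \<open>w t * K t\<close> justify Fubini, and Chapman-Kolmogorov evaluates the
  inner integral.\<close>

lemma kernel_operator_subordination:
  fixes w :: "real \<Rightarrow> real"
  assumes "\<tau> > 0" and [measurable]: "w \<in> borel_measurable borel"
    and w0: "\<And>t. t \<le> 0 \<Longrightarrow> w t = 0"
    and int: "integrable lborel (\<lambda>t. w t * K t)"
  shows "kernel_operator \<mu> p \<tau> (\<lambda>h. LINT t:{0<..}|lborel. w t * p h k t) g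
    = (LINT t:{0<..}|lborel. w t * p g k (t + \<tau>))"
proof -
  let ?F = "\<lambda>h t. p g h \<tau> * (indicator {0<..} t * (w t * p h k t))"
  \<comment> \<open>Nothing is assumed about the kernel for t <= 0, so only its cut-off to positive
    times is known to be measurable.\<close>
  have "(\<lambda>x. indicator (UNIV \<times> {0<..}) x *\<^sub>R (case x of (h, t) \<Rightarrow> p h k t)) \<in> borel_measurable borel"
    using heat_kernel_sections(5)[OF kernel]
    by (intro borel_measurable_continuous_on_indicator) (auto intro!: borel_open open_Times)
  then have m: "(\<lambda>x. indicator {0<..} (snd x) * p (fst x) k (snd x)) \<in> borel_measurable (borel \<Otimes>\<^sub>M borel)"
    unfolding borel_prod by (simp add: case_prod_unfold indicator_times)
  have "(\<lambda>x. p g (fst x) \<tau> * (w (snd x) * (indicator {0<..} (snd x) * p (fst x) k (snd x)))) \<in> borel_measurable (borel \<Otimes>\<^sub>M borel)"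
    using m assms(1) by measurable
  then have meas: "(\<lambda>(h, t). ?F h t) \<in> borel_measurable (\<mu> \<Otimes>\<^sub>M lborel)"
    by (simp add: case_prod_unfold mult_ac cong: measurable_cong_sets sets_pair_measure_cong)
  have bnd: "\<bar>indicator {0<..} t * (w t * p h k t)\<bar> \<le> \<bar>w t * K t\<bar>" for h t
  proof (cases "t > 0")
    case True
    then have "p h k t \<le> \<bar>K t\<bar>" using kernel_bound[of t h k] by linarith
    then show ?thesis using True p_pos[OF True, of h k]
      by (auto simp: abs_mult less_imp_le intro!: mult_left_mono)
  qed (simp add: w0)
  have m1: "(\<lambda>t. indicator {0<..} t * (w t * p h k t)) \<in> borel_measurable borel" for h
    using borel_measurable_continuous_on_indicator[OF _ heat_kernel_sections(4)[OF kernel], of h k]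
    by (simp add: mult.left_commute)
  have int1: "integrable lborel (\<lambda>t. indicator {0<..} t * (w t * p h k t))" for h
    using int by (rule Bochner_Integration.integrable_bound) (use m1 bnd in auto)
  have pair: "integrable (\<mu> \<Otimes>\<^sub>M lborel) (\<lambda>(h, t). ?F h t)"
  proof (rule mu_lborel.Fubini_integrable[OF meas])
    show "AE h in \<mu>. integrable lborel (\<lambda>t. case (h, t) of (h, t) \<Rightarrow> ?F h t)"
      using int1 by auto
    show "integrable \<mu> (\<lambda>h. \<integral>t. norm (case (h, t) of (h, t) \<Rightarrow> ?F h t) \<partial>lborel)"
    proof (rule Bochner_Integration.integrable_bound)
      show "integrable \<mu> (\<lambda>h. p g h \<tau> * (\<integral>t. \<bar>w t * K t\<bar> \<partial>lborel))"
        using integrable_p[OF assms(1)] by simp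
      show "AE h in \<mu>. norm (\<integral>t. norm (case (h, t) of (h, t) \<Rightarrow> ?F h t) \<partial>lborel)
          \<le> norm (p g h \<tau> * (\<integral>t. \<bar>w t * K t\<bar> \<partial>lborel))"
      proof (rule AE_I2)
        fix h
        have "(\<integral>t. \<bar>indicator {0<..} t * (w t * p h k t)\<bar> \<partial>lborel) \<le> (\<integral>t. \<bar>w t * K t\<bar> \<partial>lborel)"
          by (intro integral_mono integrable_abs int1 int bnd)
        then have "p g h \<tau> * (\<integral>t. \<bar>indicator {0<..} t * (w t * p h k t)\<bar> \<partial>lborel) \<le> p g h \<tau> * (\<integral>t. \<bar>w t * K t\<bar> \<partial>lborel)"
          using p_pos[OF assms(1)] by (intro mult_left_mono) (auto simp: less_imp_le)
        moreover have "(\<integral>t. norm (case (h, t) of (h, t) \<Rightarrow> ?F h t) \<partial>lborel)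
           = p g h \<tau> * (\<integral>t. \<bar>indicator {0<..} t * (w t * p h k t)\<bar> \<partial>lborel)"
          using p_pos[OF assms(1), of g h] by (simp add: abs_mult[of "p g h \<tau>"] less_imp_le)
        ultimately show "norm (\<integral>t. norm (case (h, t) of (h, t) \<Rightarrow> ?F h t) \<partial>lborel)
          \<le> norm (p g h \<tau> * (\<integral>t. \<bar>w t * K t\<bar> \<partial>lborel))"
          using p_pos[OF assms(1), of g h] by (simp add: abs_mult[of "p g h \<tau>"] less_imp_le)
      qed
    qed (use meas in measurable)
  qed
  have "kernel_operator \<mu> p \<tau> (\<lambda>h. LINT t:{0<..}|lborel. w t * p h k t) g
      = (\<integral>h. \<integral>t. ?F h t \<partial>lborel \<partial>\<mu>)"
    by (simp add: kernel_operator_def set_lebesgue_integral_def)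
  also have "\<dots> = (\<integral>t. \<integral>h. ?F h t \<partial>\<mu> \<partial>lborel)"
    by (rule mu_lborel.Fubini_integral[OF pair, symmetric])
  also have "\<dots> = (LINT t:{0<..}|lborel. w t * p g k (t + \<tau>))"
    unfolding set_lebesgue_integral_def
  proof (rule Bochner_Integration.integral_cong[OF refl])
    fix t :: real
    show "(\<integral>h. ?F h t \<partial>\<mu>) = indicat_real {0<..} t *\<^sub>R (w t * p g k (t + \<tau>))"
    proof (cases "t > 0")
      case True
      have "(\<integral>h. ?F h t \<partial>\<mu>) = (\<integral>h. w t * (p g h \<tau> * p h k t) \<partial>\<mu>)"
        using True by (intro Bochner_Integration.integral_cong) auto
      also have "\<dots> = w t * p g k (\<tau> + t)"
        using chapman_kolmogorov[OF assms(1) True] by simp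
      finally show ?thesis using True by (simp add: add.commute)
    qed simp
  qed
  finally show ?thesis .
qed

end

section \<open>The fractional power\<close>

theorem theorem2p1:
  fixes A :: "('g::{topological_group_add, t2_space, second_countable_topology}, 'a::euclidean_space) atlas"
    and T :: "'a \<Rightarrow> ('g \<Rightarrow> real) \<Rightarrow> real"
    and V :: "nat \<Rightarrow> 'a set" and r :: nat and E :: "'a set"
    and \<mu> :: "'g measure" and p :: "'g \<Rightarrow> 'g \<Rightarrow> real \<Rightarrow> real"
    and C \<alpha> \<beta> s y :: real and g :: 'g
  assumes "carnot_group A T V r"
    and "orthonormal_basis_of E (V 1)"
    and "haar_measure \<mu>"
    and "heat_kernel A T E \<mu> p"
    and stochastically_complete: "\<And>t h. t > 0 \<Longrightarrow> kernel_operator \<mu> p t (\<lambda>_. 1) h = 1"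
    and "C > 0" and "\<alpha> > 0" and "\<beta> > 0"
    and gaussian_lower: "\<And>t h h'. t > 0 \<Longrightarrow>
      C * t powr (- (homogeneous_dimension V r / 2))
        * exp (- \<alpha> * (control_distance A T E h h')\<^sup>2 / t) \<le> p h h' t"
    and gaussian_upper: "\<And>t h h'. t > 0 \<Longrightarrow>
      p h h' t \<le> inverse C * t powr (- (homogeneous_dimension V r / 2))
        * exp (- \<beta> * (control_distance A T E h h')\<^sup>2 / t)"
    and "0 < s" and "s < 1"
    and "2 * s < homogeneous_dimension V r"
    and "y > 0"
  shows "fractional_laplacian \<mu> p s (\<lambda>h. e_kernel p s h y) g
    = (2 * pi * y) powr (2 * s) * e_kernel p (- s) g y"
proof -
  define b where "b = homogeneous_dimension V r / 2"
  define a where "a = y\<^sup>2 / 4"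
  define u where "u \<sigma> h = (LINT t:{0<..}|lborel. subordination_weight (\<sigma> - 1) a t * p h 0 t)" for \<sigma> h
  let ?K = "\<lambda>t. inverse C * t powr (- b)"
  have a: "a > 0" and b: "s < b"
    using \<open>y > 0\<close> \<open>2 * s < _\<close> by (auto simp: a_def b_def)
  have bound: "p h k t \<le> ?K t" if "t > 0" for h k t
  proof -
    have "exp (- \<beta> * (control_distance A T E h k)\<^sup>2 / t) \<le> 1"
      using that \<open>\<beta> > 0\<close> by (simp add: divide_nonpos_pos mult_nonneg_nonneg)
    then have "?K t * exp (- \<beta> * (control_distance A T E h k)\<^sup>2 / t) \<le> ?K t"
      using \<open>C > 0\<close> by (intro mult_left_le) auto
    then show ?thesis using gaussian_upper[OF that, of h k] by (simp add: b_def)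
  qed
  interpret bounded_heat_kernel A T E \<mu> p ?K
  proof
    show "smooth_atlas A" using assms(1) by (simp add: carnot_group_def lie_group_def)
  qed (fact assms(3,4) stochastically_complete bound)+
  \<comment> \<open>Used for both signs: \<sigma> = s on the left side of the theorem and \<sigma> =
    -s on the right.\<close>
  have e: "e_kernel p \<sigma> h y = (4 * pi) powr (\<sigma> - 1) * u \<sigma> h" for \<sigma> h
    unfolding e_kernel_def u_def set_integral_mult_right[symmetric]
  proof (rule set_lebesgue_integral_cong)
    show "\<forall>t. t \<in> {0<..} \<longrightarrow> q_kernel p \<sigma> h t y =
        (4 * pi) powr (\<sigma> - 1) * (subordination_weight (\<sigma> - 1) a t * p h 0 t)"
    proof (intro allI impI)
      fix t :: real assume "t \<in> {0<..}"
      then have t: "t > 0" by simp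
      have "1 / (4 * pi * t) powr (1 - \<sigma>) = (4 * pi) powr (\<sigma> - 1) * t powr (\<sigma> - 1)"
        using t powr_minus_divide[of "4 * pi * t" "1 - \<sigma>"] by (simp add: powr_mult)
      then show "q_kernel p \<sigma> h t y = (4 * pi) powr (\<sigma> - 1) * (subordination_weight (\<sigma> - 1) a t * p h 0 t)"
        using t by (simp add: q_kernel_def subordination_weight_def a_def)
    qed
  qed simp
  have P: "kernel_operator \<mu> p \<tau> (u s) g
      = (LINT t:{0<..}|lborel. subordination_weight (s - 1) a t * p g 0 (t + \<tau>))" if "\<tau> > 0" for \<tau>
    unfolding u_def
  proof (rule kernel_operator_subordination[OF that])
    have "integrable lborel (subordination_weight (s - 1 + - b) a)"
      using a b \<open>s < 1\<close> by (intro integrable_subordination_weight) auto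
    then have "integrable lborel (\<lambda>t. inverse C * (subordination_weight (s - 1) a t * t powr (- b)))"
      unfolding subordination_weight_mult_powr by simp
    then show "integrable lborel (\<lambda>t. subordination_weight (s - 1) a t * ?K t)"
      by (simp only: mult.left_commute)
  qed (auto simp: subordination_weight_def)
  have "(LINT \<tau>:{0<..}|lborel. 1 / \<tau> powr (1 + s)
        * (kernel_operator \<mu> p \<tau> (\<lambda>h. e_kernel p s h y) g - e_kernel p s g y))
     = (LINT \<tau>:{0<..}|lborel. (4 * pi) powr (s - 1) * (\<tau> powr (-1 - s) *
       ((LINT t:{0<..}|lborel. subordination_weight (s - 1) a t * p g 0 (t + \<tau>))
        - (LINT t:{0<..}|lborel. subordination_weight (s - 1) a t * p g 0 t))))"
  proof (rule set_lebesgue_integral_cong)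
    show "\<forall>\<tau>. \<tau> \<in> {0<..} \<longrightarrow> 1 / \<tau> powr (1 + s)
        * (kernel_operator \<mu> p \<tau> (\<lambda>h. e_kernel p s h y) g - e_kernel p s g y)
      = (4 * pi) powr (s - 1) * (\<tau> powr (-1 - s) *
       ((LINT t:{0<..}|lborel. subordination_weight (s - 1) a t * p g 0 (t + \<tau>))
        - (LINT t:{0<..}|lborel. subordination_weight (s - 1) a t * p g 0 t)))"
    proof (intro allI impI)
      fix \<tau> :: real assume "\<tau> \<in> {0<..}"
      then have \<tau>: "\<tau> > 0" by simp
      have lin: "kernel_operator \<mu> p \<tau> (\<lambda>h. e_kernel p s h y) g
          = (4 * pi) powr (s - 1) * kernel_operator \<mu> p \<tau> (u s) g"
        unfolding e kernel_operator_def
        by (simp only: mult.left_commute[of _ "(4 * pi) powr (s - 1)"] integral_mult_right_zero)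
      have pw: "1 / \<tau> powr (1 + s) = \<tau> powr (-1 - s)"
        using powr_minus_divide[of \<tau> "1 + s"] by simp
      show "1 / \<tau> powr (1 + s)
        * (kernel_operator \<mu> p \<tau> (\<lambda>h. e_kernel p s h y) g - e_kernel p s g y)
      = (4 * pi) powr (s - 1) * (\<tau> powr (-1 - s) *
       ((LINT t:{0<..}|lborel. subordination_weight (s - 1) a t * p g 0 (t + \<tau>))
        - (LINT t:{0<..}|lborel. subordination_weight (s - 1) a t * p g 0 t)))"
        unfolding lin unfolding e P[OF \<tau>, symmetric] u_def[symmetric] pw by (simp add: algebra_simps)
    qed
  qed simp
  also have "\<dots> = (4 * pi) powr (s - 1) *
      (- (Gamma (1 - s) / s) * a powr s * (LINT t:{0<..}|lborel. subordination_weight (-1 - s) a t * p g 0 t))"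
  proof (subst set_integral_mult_right, subst fractional_power_of_subordination[OF a \<open>0 < s\<close> \<open>s < 1\<close> b])
    show "(\<lambda>t. indicator {0<..} t * p g 0 t) \<in> borel_measurable borel"
      using borel_measurable_continuous_on_indicator[OF _ heat_kernel_sections(4)[OF kernel], of g 0] by simp
    show "\<bar>p g 0 t\<bar> \<le> ?K t" if "t > 0" for t
      using bound[OF that, of g 0] p_pos[OF that, of g 0] by simp
  qed simp
  also have "(LINT t:{0<..}|lborel. subordination_weight (-1 - s) a t * p g 0 t) = u (- s) g"
  proof -
    have "-1 - s = - s - 1" by simp
    then show ?thesis by (simp only: u_def)
  qed
  \<comment> \<open>The normalisation s / Gamma(1 - s) cancels the factor Gamma(1 - s) / s of the
    Marchaud integral, and the two minus signs cancel each other.\<close>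
  finally have "fractional_laplacian \<mu> p s (\<lambda>h. e_kernel p s h y) g
      = (4 * pi) powr (s - 1) * a powr s * u (- s) g"
    using \<open>0 < s\<close> Gamma_real_pos[of "1 - s"] \<open>s < 1\<close>
    by (simp add: fractional_laplacian_def less_imp_neq[THEN not_sym])
  moreover have "(2 * pi * y) powr (2 * s) * (4 * pi) powr (- s - 1) = (4 * pi) powr (s - 1) * a powr s"
  proof -
    have sq: "x\<^sup>2 powr s = x powr (2 * s)" if "x > 0" for x :: real
      using that by (simp add: powr_powr flip: powr_numeral)
    have "(2 * pi * y) powr (2 * s) = ((4 * pi)\<^sup>2 * a) powr s"
    proof -
      \<comment> \<open>The origin of (2 pi y)^(2s): with a = y^2/4, the power a^s combines with (4
        pi)^(2s), the ratio of the prefactors (4 pi)^(s-1) and (4 pi)^(-s-1).\<close>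
      have "(2 * pi * y)\<^sup>2 = (4 * pi)\<^sup>2 * a" by (simp add: a_def power2_eq_square)
      then show ?thesis using sq[of "2 * pi * y"] \<open>y > 0\<close> by simp
    qed
    also have "\<dots> = (4 * pi) powr (2 * s) * a powr s"
      using sq[of "4 * pi"] a by (subst powr_mult) simp_all
    finally have "(2 * pi * y) powr (2 * s) * (4 * pi) powr (- s - 1)
        = (4 * pi) powr (2 * s) * (4 * pi) powr (- s - 1) * a powr s"
      by simp
    also have "\<dots> = (4 * pi) powr (s - 1) * a powr s"
      unfolding powr_add[symmetric] by simp
    finally show ?thesis .
  qed
  ultimately show ?thesis unfolding e by (simp flip: mult.assoc)
qed

end
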